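(* Let $(X,E)$ be a finite connected graph (no self-loops or multiple edges), $A$ its adjacency matrix and $D$ the diagonal matrix of the degrees $d_x$, $x\in X$. Let $0<u<1$ satisfy $u<\inf\{\frac1{d_x-1}:x\in X\}$ (with $\frac10=+\infty$). Then: (a) $\displaystyle\sum_{m=2}^\infty L_m u^m=(1-u^2)\,\mathrm{Tr}\big([I+(D-I)u^2-uA]^{-1}\big)-|X|$, where $L_m$ is the number of geodesic based loops of length $m$. (b) $\displaystyle IZ(u)=(1-u^2)^{-\chi}\det\big(I-uA+u^2(D-I)\big)^{-1}$, where $\chi=|E|-|X|$ and $IZ(u)=\prod_{\gamma\in\mathfrak P}(1-u^{p(\gamma)})^{-1}$ is Ihara's zeta function of the graph.
   Context: A geodesic based loop of length $m$ is a sequence $(\xi_1,\dots,\xi_m)$ of vertices such that, setting $\xi_{m+1}=\xi_1$, $\{\xi_i,\xi_{i+1}\}\in E$ for $1\le i\le m$ and there is no backtracking except possibly at the base point: $\xi_{i-1}\ne\xi_{i+1}$ for $2\le i\le m$. It is tailless if in addition there is no backtracking at the base point, i.e. $\xi_{i-1}\neq\xi_{i+1}$ for all $i$ taken modulo $m$. A geodesic loop is an equivalence class of tailless geodesic based loops under cyclic shift; a loop and its reversal are in general different. It is primitive if its representatives are not the concatenation of $n\ge2$ identical based loops. $\mathfrak P$ is the set of primitive geodesic loops, and $p(\gamma)$ is the length of $\gamma$. *)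

theory Defs
  imports "HOL-Analysis.Analysis"
begin

text \<open>
  A graph is given by its edge set \<open>E :: 'v set set\<close>; the vertex set is the whole
  type \<open>'v\<close>, so a finite graph is one over \<open>'v :: finite\<close> and matrices
  indexed by vertices have type \<open>real ^ 'v ^ 'v\<close>.
\<close>

definition simple_graph :: "'v set set \<Rightarrow> bool" where
  "simple_graph E \<longleftrightarrow> (\<forall>e\<in>E. card e = 2)"

definition connected_graph :: "'v set set \<Rightarrow> bool" where
  "connected_graph E \<longleftrightarrow> (\<forall>x y. (x, y) \<in> {(a, b). {a, b} \<in> E}\<^sup>*)"

definition vertex_degree :: "'v set set \<Rightarrow> 'v \<Rightarrow> nat" where
  "vertex_degree E x = card {e \<in> E. x \<in> e}"

definition adjacency_matrix :: "'v::finite set set \<Rightarrow> real ^ 'v ^ 'v" where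
  "adjacency_matrix E = (\<chi> x y. if {x, y} \<in> E then 1 else 0)"

definition degree_matrix :: "'v::finite set set \<Rightarrow> real ^ 'v ^ 'v" where
  "degree_matrix E = (\<chi> x y. if x = y then real (vertex_degree E x) else 0)"

text \<open>
  A based loop \<open>(\<xi>\<^sub>1, \<dots>, \<xi>\<^sub>m)\<close> is a nonempty list with \<open>\<xi>\<^sub>i = xs ! (i - 1)\<close>,
  and \<open>\<xi>\<^sub>m\<^sub>+\<^sub>1 = \<xi>\<^sub>1\<close> is obtained by reducing list indices modulo \<open>m\<close>.
\<close>

definition based_loop :: "'v set set \<Rightarrow> 'v list \<Rightarrow> bool" where
  "based_loop E xs \<longleftrightarrow> xs \<noteq> [] \<and>
     (\<forall>i < length xs. {xs ! i, xs ! (Suc i mod length xs)} \<in> E)"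

text \<open>Backtracking at the base point would be the case \<open>i = 0\<close>; it is allowed.\<close>

definition geodesic_based_loop :: "'v set set \<Rightarrow> 'v list \<Rightarrow> bool" where
  "geodesic_based_loop E xs \<longleftrightarrow> based_loop E xs \<and>
     (\<forall>i. 1 \<le> i \<and> i < length xs \<longrightarrow> xs ! (i - 1) \<noteq> xs ! (Suc i mod length xs))"

text \<open>The term \<open>i + length xs - 1\<close> is \<open>i - 1\<close> modulo the length without truncation at \<open>i = 0\<close>.\<close>

definition tailless :: "'v list \<Rightarrow> bool" where
  "tailless xs \<longleftrightarrow>
     (\<forall>i < length xs. xs ! ((i + length xs - 1) mod length xs) \<noteq> xs ! (Suc i mod length xs))"

definition num_geodesic_based_loops :: "'v set set \<Rightarrow> nat \<Rightarrow> nat" where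
  "num_geodesic_based_loops E m = card {xs. geodesic_based_loop E xs \<and> length xs = m}"

definition cyclic_shift :: "('v list \<times> 'v list) set" where
  "cyclic_shift = {(xs, ys). \<exists>k. ys = rotate k xs}"

definition geodesic_loops :: "'v set set \<Rightarrow> 'v list set set" where
  "geodesic_loops E = {xs. geodesic_based_loop E xs \<and> tailless xs} // cyclic_shift"

definition primitive_geodesic_loops :: "'v set set \<Rightarrow> 'v list set set" where
  "primitive_geodesic_loops E = {\<gamma> \<in> geodesic_loops E.
     \<forall>xs\<in>\<gamma>. \<not> (\<exists>n\<ge>2. \<exists>ys. based_loop E ys \<and> xs = concat (replicate n ys))}"

text \<open>All representatives of a loop have the same length.\<close>

definition loop_length :: "'v list set \<Rightarrow> nat" where
  "loop_length \<gamma> = the_elem (length ` \<gamma>)"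

text \<open>
  Unordered infinite products, as the limit over the finite subsets of the index set
  (the multiplicative counterpart of \<^const>\<open>infsum\<close>). As usual for infinite
  products, convergence includes that the limit is nonzero.
\<close>

definition unordered_prod_converges :: "('i \<Rightarrow> real) \<Rightarrow> 'i set \<Rightarrow> bool" where
  "unordered_prod_converges f A \<longleftrightarrow>
     (\<exists>p. p \<noteq> 0 \<and> (prod f \<longlongrightarrow> p) (finite_subsets_at_top A))"

definition unordered_prod :: "('i \<Rightarrow> real) \<Rightarrow> 'i set \<Rightarrow> real" where
  "unordered_prod f A = Lim (finite_subsets_at_top A) (prod f)"

definition ihara_factor :: "real \<Rightarrow> 'v list set \<Rightarrow> real" where
  "ihara_factor u \<gamma> = inverse (1 - u ^ loop_length \<gamma>)"

definition ihara_zeta :: "'v set set \<Rightarrow> real \<Rightarrow> real" where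
  "ihara_zeta E u = unordered_prod (ihara_factor u) (primitive_geodesic_loops E)"

text \<open>The number \<open>\<chi> = |E| - |X|\<close>, which may be negative.\<close>

definition chi :: "'v::finite set set \<Rightarrow> int" where
  "chi E = int (card E) - int CARD('v)"

end

theory Submission
  imports Defs
begin

text \<open>
  Let \<open>A\<^sub>m\<close> be the matrix counting geodesic paths of length \<open>m\<close>. The recursion
  \<open>A\<^sub>m\<^sub>+\<^sub>2 = A A\<^sub>m\<^sub>+\<^sub>1 - (D - I) A\<^sub>m\<close>, with the correction \<open>-I\<close> at \<open>m = 0\<close>, says that
  \<open>G(u) = \<Sum> A\<^sub>m u\<^sup>m\<close> equals \<open>(1 - u\<^sup>2) M(u)\<^sup>-\<^sup>1\<close> for
  \<open>M(u) = I - uA + u\<^sup>2(D - I)\<close>; taking traces gives (a).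

  For (b), let \<open>N\<^sub>m\<close> be the number of tailless geodesic based loops of length \<open>m\<close>. Removing one
  tail edge shows \<open>N\<^sub>m\<^sub>+\<^sub>2 - N\<^sub>m = L\<^sub>m\<^sub>+\<^sub>2 - Tr ((D - I) A\<^sub>m)\<close> for \<open>m > 0\<close>, so that
  \<open>\<Sum> N\<^sub>m u\<^sup>m = 2 \<chi> u\<^sup>2 / (1 - u\<^sup>2) - u Tr (M(u)\<^sup>-\<^sup>1 M'(u))\<close>. Since every tailless loop is a power
  of a unique primitive one, \<open>IZ(u) = exp (\<Sum> N\<^sub>m u\<^sup>m / m)\<close>. Hence the logarithmic derivatives of
  \<open>IZ(u)\<close> and \<open>(1 - u\<^sup>2) powi (- \<chi>) / det M(u)\<close> agree, and both functions are 1 at \<open>u = 0\<close>.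
\<close>

subsection \<open>Counting non-backtracking walks\<close>

text \<open>These rules turn \<open>of_bool\<close> weights into cardinalities or restricted index
  sets. With the weights kept, sums range over \<open>UNIV\<close> and can be swapped and split by
  linearity.\<close>

declare sum_of_bool_eq [simp del] sum_of_bool_mult_eq [simp del] sum_mult_of_bool_eq [simp del]

abbreviation adj :: "'v set set \<Rightarrow> 'v \<Rightarrow> 'v \<Rightarrow> real" where
  "adj E x y \<equiv> of_bool ({x, y} \<in> E)"

section \<open>Degrees, neighbours and incident edges\<close>

lemma simple_graph_irrefl: "simple_graph E \<Longrightarrow> {x, x} \<notin> E"
  by (auto simp: simple_graph_def)

text \<open>An edge at \<open>x\<close> is determined by its other endpoint, so counting incident
  edges amounts to counting neighbours.\<close>

lemma sum_adj_eq_degree: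
  fixes E :: "'v::finite set set"
  assumes "simple_graph E"
  shows "(\<Sum>y\<in>UNIV. adj E x y) = real (vertex_degree E x)"
proof -
  have "bij_betw (\<lambda>y. {x, y}) {y. {x, y} \<in> E} {e \<in> E. x \<in> e}"
  proof (rule bij_betwI')
    fix e assume "e \<in> {e \<in> E. x \<in> e}"
    with assms obtain y z where "e = {y, z}" "x \<in> e" "e \<in> E"
      by (auto simp: simple_graph_def card_2_iff)
    then show "\<exists>y\<in>{y. {x, y} \<in> E}. e = {x, y}"
      by (auto simp: insert_commute)
  qed (auto simp: doubleton_eq_iff)
  then show ?thesis
    by (simp add: vertex_degree_def of_bool_def sum.If_cases bij_betw_same_card)
qed

text \<open>Handshake lemma: count the incidences by vertices and then by edges.\<close>

lemma sum_degrees: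
  fixes E :: "'v::finite set set"
  assumes "simple_graph E"
  shows "(\<Sum>x\<in>UNIV. vertex_degree E x) = 2 * card E"
proof -
  have "(\<Sum>x\<in>UNIV. vertex_degree E x) = (\<Sum>x\<in>UNIV. \<Sum>e\<in>E. of_bool (x \<in> e))"
    by (simp add: vertex_degree_def of_bool_def sum.If_cases Collect_conj_eq)
  also have "\<dots> = (\<Sum>e\<in>E. \<Sum>x\<in>UNIV. of_bool (x \<in> e))"
    by (rule sum.swap)
  also have "\<dots> = (\<Sum>e\<in>E. 2)"
    using assms by (intro sum.cong) (auto simp: simple_graph_def of_bool_def sum.If_cases)
  finally show ?thesis by simp
qed

text \<open>The number of non-backtracking walks with \<open>m + 1\<close> edges, first step
  from \<open>x\<close> to \<open>y\<close> and last step from \<open>s\<close> to \<open>t\<close>.\<close>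

fun nbw :: "'v::finite set set \<Rightarrow> nat \<Rightarrow> 'v \<Rightarrow> 'v \<Rightarrow> 'v \<Rightarrow> 'v \<Rightarrow> real" where
  "nbw E 0 x y s t = adj E x y * of_bool (x = s \<and> y = t)"
| "nbw E (Suc m) x y s t = adj E x y * (\<Sum>w\<in>UNIV. of_bool (w \<noteq> x) * nbw E m y w s t)"

lemma nbw_nonneg: "0 \<le> nbw E m x y s t"
  by (induction m arbitrary: x y) (auto intro!: sum_nonneg)

lemma adj_mult_nbw: "adj E x y * nbw E m x y s t = nbw E m x y s t"
  by (cases m) auto

text \<open>The defining recursion removes the first step; this one removes the last, where tails
  are detected. In the induction step the conditions at the two ends do not interact, so the sums
  over \<open>w\<close> and \<open>r\<close> commute.\<close>

lemma nbw_Suc_right: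
  "nbw E (Suc m) x y s t = adj E s t * (\<Sum>r\<in>UNIV. of_bool (r \<noteq> t) * nbw E m x y r s)"
proof (induction m arbitrary: x y)
  case 0
  have "(\<Sum>w\<in>UNIV. of_bool (w \<noteq> x) * (adj E y w * of_bool (y = s \<and> w = t)))
     = (\<Sum>w\<in>UNIV. if w = t then of_bool (w \<noteq> x) * (adj E y w * of_bool (y = s)) else 0)"
    by (intro sum.cong) auto
  moreover have "(\<Sum>r\<in>UNIV. of_bool (r \<noteq> t) * (adj E x y * of_bool (x = r \<and> y = s)))
     = (\<Sum>r\<in>UNIV. if r = x then of_bool (r \<noteq> t) * (adj E x y * of_bool (y = s)) else 0)"
    by (intro sum.cong) auto
  ultimately show ?case by auto
next
  case (Suc m)
  have "nbw E (Suc (Suc m)) x y s t = adj E x y * (\<Sum>w\<in>UNIV. of_bool (w \<noteq> x) *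
      (adj E s t * (\<Sum>r\<in>UNIV. of_bool (r \<noteq> t) * nbw E m y w r s)))"
    unfolding nbw.simps(2)[of E "Suc m"] Suc.IH ..
  also have "\<dots> = adj E s t * (\<Sum>w\<in>UNIV. \<Sum>r\<in>UNIV.
      of_bool (r \<noteq> t) * (adj E x y * (of_bool (w \<noteq> x) * nbw E m y w r s)))"
    by (simp add: sum_distrib_left mult_ac del: of_bool_eq_iff)
  also have "\<dots> = adj E s t * (\<Sum>r\<in>UNIV. \<Sum>w\<in>UNIV.
      of_bool (r \<noteq> t) * (adj E x y * (of_bool (w \<noteq> x) * nbw E m y w r s)))"
    by (subst sum.swap) simp
  also have "\<dots> = adj E s t * (\<Sum>r\<in>UNIV. of_bool (r \<noteq> t) * nbw E (Suc m) x y r s)"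
    by (simp add: sum_distrib_left)
  finally show ?case .
qed

lemma adj_mult_nbw_right: "adj E s t * nbw E m x y s t = nbw E m x y s t"
  by (cases m) (auto simp: nbw_Suc_right simp del: nbw.simps(2))

lemma sum_of_bool_neq_mult:
  fixes f :: "'a::finite \<Rightarrow> real"
  shows "(\<Sum>w\<in>UNIV. of_bool (w \<noteq> x) * f w) = (\<Sum>w\<in>UNIV. f w) - f x"
proof -
  have "(\<Sum>w\<in>UNIV. of_bool (w \<noteq> x) * f w) = (\<Sum>w\<in>UNIV. f w - (if w = x then f w else 0))"
    by (intro sum.cong) auto
  then show ?thesis by (simp add: sum_subtractf)
qed

lemma sum_of_bool_eq_mult:
  fixes f :: "'a::finite \<Rightarrow> real"
  shows "(\<Sum>s\<in>UNIV. of_bool (w = s) * f s) = f w"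
proof -
  have "(\<Sum>s\<in>UNIV. of_bool (w = s) * f s) = (\<Sum>s\<in>UNIV. if s = w then f s else 0)"
    by (intro sum.cong) auto
  then show ?thesis by simp
qed

text \<open>After the first edge every step has at most \<open>q\<close> continuations, the vertex
  just left being excluded. The convergence of all later power series rests on this bound.\<close>

lemma sum_nbw_le:
  fixes q :: real
  assumes "simple_graph E" and deg: "\<And>x. real (vertex_degree E x) \<le> q + 1" and "q \<ge> 0"
  shows "(\<Sum>s\<in>UNIV. \<Sum>t\<in>UNIV. nbw E m x y s t) \<le> q ^ m"
proof (induction m arbitrary: x y)
  case 0
  have "(\<Sum>s\<in>UNIV. \<Sum>t\<in>UNIV. nbw E 0 x y s t)
      = (\<Sum>s\<in>UNIV. \<Sum>t\<in>UNIV. if s = x then if t = y then adj E x y else 0 else 0)"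
    by (intro sum.cong) auto
  also have "\<dots> = (\<Sum>s\<in>UNIV. if s = x then adj E x y else 0)"
    by (intro sum.cong) auto
  finally show ?case by simp
next
  case (Suc m)
  let ?S = "\<lambda>y w. \<Sum>s\<in>UNIV. \<Sum>t\<in>UNIV. nbw E m y w s t"
  show ?case
  proof (cases "{x, y} \<in> E")
    case True
    have "(\<Sum>s\<in>UNIV. \<Sum>t\<in>UNIV. nbw E (Suc m) x y s t)
      = (\<Sum>s\<in>UNIV. \<Sum>w\<in>UNIV. \<Sum>t\<in>UNIV. of_bool (w \<noteq> x) * nbw E m y w s t)"
      using True by (simp, subst sum.swap) simp
    also have "\<dots> = (\<Sum>w\<in>UNIV. of_bool (w \<noteq> x) * ?S y w)"
      by (subst sum.swap) (simp add: sum_distrib_left)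
    \<comment> \<open>Restoring the edge weight before the induction hypothesis restricts the bound
      to the neighbours of \<open>y\<close>.\<close>
    also have "\<dots> = (\<Sum>w\<in>UNIV. of_bool (w \<noteq> x) * (adj E y w * ?S y w))"
      by (simp add: sum_distrib_left adj_mult_nbw)
    also have "\<dots> \<le> (\<Sum>w\<in>UNIV. of_bool (w \<noteq> x) * (adj E y w * q ^ m))"
      using Suc.IH by (intro sum_mono mult_left_mono) auto
    also have "\<dots> = (\<Sum>w\<in>UNIV. adj E y w) * q ^ m - adj E y x * q ^ m"
      by (simp add: sum_of_bool_neq_mult sum_distrib_right)
    also have "\<dots> = (real (vertex_degree E y) - 1) * q ^ m"
    proof -
      have "adj E y x = 1" using True by (simp add: insert_commute)
      then show ?thesis by (simp add: sum_adj_eq_degree[OF assms(1)] algebra_simps)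
    qed
    also have "\<dots> \<le> q * q ^ m"
      using deg[of y] \<open>q \<ge> 0\<close> by (intro mult_right_mono) auto
    finally show ?thesis by simp
  qed (use \<open>q \<ge> 0\<close> in simp)
qed

text \<open>Entries of the matrices \<open>A\<^sub>m\<close> counting geodesic paths of length \<open>m\<close>.\<close>

fun geo :: "'v::finite set set \<Rightarrow> nat \<Rightarrow> 'v \<Rightarrow> 'v \<Rightarrow> real" where
  "geo E 0 x z = of_bool (x = z)"
| "geo E (Suc m) x z = (\<Sum>y\<in>UNIV. \<Sum>s\<in>UNIV. nbw E m x y s z)"

lemma geo_nonneg: "0 \<le> geo E m x z"
  by (cases m) (auto intro!: sum_nonneg nbw_nonneg)

lemma geo_1: "geo E (Suc 0) x z = adj E x z"
proof -
  have "geo E (Suc 0) x z = (\<Sum>y\<in>UNIV. \<Sum>s\<in>UNIV. if s = x then if y = z then adj E x z else 0 else 0)"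
    unfolding geo.simps by (intro sum.cong) auto
  also have "\<dots> = (\<Sum>y\<in>UNIV. if y = z then adj E x z else 0)"
    by (intro sum.cong) auto
  finally show ?thesis by simp
qed

lemma geo_Suc_le:
  fixes E :: "'v::finite set set" and q :: real
  assumes "simple_graph E" and deg: "\<And>x. real (vertex_degree E x) \<le> q + 1" and "q \<ge> 0"
  shows "geo E (Suc m) x z \<le> CARD('v) * q ^ m"
proof -
  have "geo E (Suc m) x z \<le> (\<Sum>y\<in>UNIV. \<Sum>s\<in>UNIV. \<Sum>t\<in>UNIV. nbw E m x y s t)"
    unfolding geo.simps by (intro sum_mono member_le_sum) (auto intro: nbw_nonneg)
  also have "\<dots> \<le> (\<Sum>y\<in>(UNIV :: 'v set). q ^ m)"
    by (intro sum_mono sum_nbw_le assms)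
  finally show ?thesis by simp
qed

text \<open>Prepend an edge from \<open>x\<close> to \<open>y\<close> to a geodesic path starting at
  \<open>y\<close>, and discard the results that return to \<open>x\<close> at once. A discarded one
  is a geodesic path from \<open>x\<close> preceded by a neighbour other than its second vertex,
  hence the factor degree - 1; a path of length 0 has no second vertex, which yields the
  correction.\<close>

lemma geo_rec:
  assumes "simple_graph E"
  shows "geo E (Suc (Suc m)) x z = (\<Sum>y\<in>UNIV. adj E x y * geo E (Suc m) y z)
      - (real (vertex_degree E x) - 1) * geo E m x z - of_bool (m = 0 \<and> x = z)"
proof -
  \<comment> \<open>All continuations from \<open>y\<close> minus the one back to
    \<open>x\<close>.\<close>
  have swap: "(\<Sum>s\<in>UNIV. nbw E (Suc m) x y s z)
      = adj E x y * (geo E (Suc m) y z - (\<Sum>s\<in>UNIV. nbw E m y x s z))" for x y m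
  proof -
    have "(\<Sum>s\<in>UNIV. nbw E (Suc m) x y s z)
       = adj E x y * (\<Sum>w\<in>UNIV. of_bool (w \<noteq> x) * (\<Sum>s\<in>UNIV. nbw E m y w s z))"
      by (simp add: sum_distrib_left mult.assoc, subst sum.swap) simp
    then show ?thesis by (simp add: sum_of_bool_neq_mult)
  qed
  have "(\<Sum>y\<in>UNIV. adj E x y * (\<Sum>s\<in>UNIV. nbw E m y x s z))
      = (\<Sum>y\<in>UNIV. \<Sum>s\<in>UNIV. nbw E m y x s z)"
    by (simp add: sum_distrib_left insert_commute[of x] adj_mult_nbw)
  also have "\<dots> = (real (vertex_degree E x) - 1) * geo E m x z + of_bool (m = 0 \<and> x = z)"
  proof (cases m)
    case 0
    have "(\<Sum>s\<in>UNIV. nbw E 0 y x s z) = adj E x y * of_bool (x = z)" for y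
    proof -
      have "(\<Sum>s\<in>UNIV. nbw E 0 y x s z) = (\<Sum>s\<in>UNIV. if s = y then adj E x y * of_bool (x = z) else 0)"
        by (intro sum.cong) (auto simp: insert_commute)
      then show ?thesis by simp
    qed
    then show ?thesis
      using 0 sum_adj_eq_degree[OF assms] by (simp flip: sum_distrib_right)
  next
    case (Suc k)
    \<comment> \<open>By \<open>swap\<close> again, \<open>y\<close> runs over the neighbours of
      \<open>x\<close> except the next vertex of the path. Summed over \<open>y\<close>, the
      excluded terms add up to one full copy of \<open>geo\<close>.\<close>
    have "(\<Sum>y\<in>UNIV. \<Sum>s\<in>UNIV. nbw E m y x s z)
        = (\<Sum>y\<in>UNIV. adj E x y * geo E (Suc k) x z - (\<Sum>s\<in>UNIV. adj E x y * nbw E k x y s z))"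
      unfolding Suc swap by (simp add: insert_commute right_diff_distrib sum_distrib_left)
    also have "\<dots> = vertex_degree E x * geo E (Suc k) x z - geo E (Suc k) x z"
      by (simp only: sum_subtractf adj_mult_nbw geo.simps sum_adj_eq_degree[OF assms]
          flip: sum_distrib_right)
    finally show ?thesis using Suc by (simp add: algebra_simps)
  qed
  finally have *: "(\<Sum>y\<in>UNIV. adj E x y * (\<Sum>s\<in>UNIV. nbw E m y x s z))
      = (real (vertex_degree E x) - 1) * geo E m x z + of_bool (m = 0 \<and> x = z)" .
  have "geo E (Suc (Suc m)) x z
      = (\<Sum>y\<in>UNIV. adj E x y * (geo E (Suc m) y z - (\<Sum>s\<in>UNIV. nbw E m y x s z)))"
    unfolding geo.simps(2)[of E "Suc m"] swap ..
  also have "\<dots> = (\<Sum>y\<in>UNIV. adj E x y * geo E (Suc m) y z)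
      - (\<Sum>y\<in>UNIV. adj E x y * (\<Sum>s\<in>UNIV. nbw E m y x s z))"
    by (simp only: right_diff_distrib sum_subtractf)
  finally show ?thesis using * by simp
qed

text \<open>A tailless based loop of length \<open>m\<close>, prolonged by its own first edge, is a walk with
  \<open>m + 1\<close> edges. The case \<open>m = 0\<close> is set apart since the sum would count the edges.\<close>

definition closed_nb :: "'v::finite set set \<Rightarrow> nat \<Rightarrow> real" where
  "closed_nb E m = (if m = 0 then 0 else \<Sum>x\<in>UNIV. \<Sum>y\<in>UNIV. nbw E m x y x y)"

lemma closed_nb_nonneg: "0 \<le> closed_nb E m"
  by (auto simp: closed_nb_def intro!: sum_nonneg nbw_nonneg)

lemma closed_nb_le:
  fixes E :: "'v::finite set set" and q :: real
  assumes "simple_graph E" and deg: "\<And>x. real (vertex_degree E x) \<le> q + 1" and "q \<ge> 0"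
  shows "closed_nb E m \<le> (CARD('v))\<^sup>2 * q ^ m"
proof -
  have *: "nbw E m x y x y \<le> q ^ m" for x y
  proof -
    have "nbw E m x y x y \<le> (\<Sum>t\<in>UNIV. nbw E m x y x t)"
      by (intro member_le_sum) (auto intro: nbw_nonneg)
    also have "\<dots> \<le> (\<Sum>s\<in>UNIV. \<Sum>t\<in>UNIV. nbw E m x y s t)"
      by (rule member_le_sum[of x UNIV "\<lambda>s. \<Sum>t\<in>UNIV. nbw E m x y s t"])
        (auto intro!: nbw_nonneg sum_nonneg)
    finally show ?thesis using sum_nbw_le[OF assms] by (rule order_trans)
  qed
  have "(\<Sum>x\<in>UNIV. \<Sum>y\<in>UNIV. nbw E m x y x y) \<le> (\<Sum>x\<in>(UNIV::'v set). \<Sum>y\<in>(UNIV::'v set). q ^ m)"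
    by (intro sum_mono *)
  then show ?thesis using \<open>q \<ge> 0\<close> by (auto simp: closed_nb_def power2_eq_square)
qed

text \<open>A walk \<open>x, y, ..., s, x, y\<close> is a geodesic based loop at \<open>x\<close>
  prolonged by its first edge, and the prolongation backtracks exactly if \<open>s = y\<close>.
  These loops with a tail are subtracted.\<close>

lemma closed_nb_Suc:
  "closed_nb E (Suc m) = (\<Sum>x\<in>UNIV. geo E (Suc m) x x) - (\<Sum>x\<in>UNIV. \<Sum>y\<in>UNIV. nbw E m x y y x)"
proof -
  have "nbw E (Suc m) x y x y = (\<Sum>s\<in>UNIV. nbw E m x y s x) - nbw E m x y y x" for x y
    unfolding nbw_Suc_right[of E m x y] sum_of_bool_neq_mult right_diff_distrib sum_distrib_left
    by (intro arg_cong2[where f=minus] sum.cong) (auto simp: adj_mult_nbw)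
  then show ?thesis by (simp only: closed_nb_def sum_subtractf geo.simps) simp
qed

text \<open>Both excluded vertices are neighbours of \<open>y\<close>, so two are lost, or only one
  if they coincide.\<close>

lemma sum_neq2_adj:
  fixes E :: "'v::finite set set"
  assumes "simple_graph E" and "{y, w} \<in> E" and "{y, s} \<in> E"
  shows "(\<Sum>x\<in>UNIV. adj E x y * (of_bool (w \<noteq> x) * of_bool (s \<noteq> x)))
    = real (vertex_degree E y) - 2 + of_bool (w = s)"
proof -
  have "(\<Sum>x\<in>UNIV. adj E x y * (of_bool (w \<noteq> x) * of_bool (s \<noteq> x)))
    = (\<Sum>x\<in>UNIV. of_bool (x \<noteq> w) * (of_bool (x \<noteq> s) * adj E y x))"
    by (intro sum.cong) (auto simp: insert_commute)
  also have "\<dots> = real (vertex_degree E y) - 1 - of_bool (w \<noteq> s)"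
    using assms by (simp add: sum_of_bool_neq_mult sum_adj_eq_degree)
  finally show ?thesis by auto
qed

text \<open>Strip the outermost tail edge \<open>x \<rightarrow> y\<close>; it can be reattached at any neighbour
  of \<open>y\<close> other than the second and the penultimate vertex of the remaining loop.\<close>

lemma tail_rec:
  assumes "simple_graph E"
  shows "(\<Sum>x\<in>UNIV. \<Sum>y\<in>UNIV. nbw E (Suc (Suc m)) x y y x)
    = (\<Sum>y\<in>UNIV. (real (vertex_degree E y) - 2) * geo E (Suc m) y y)
      + (\<Sum>y\<in>UNIV. \<Sum>w\<in>UNIV. nbw E m y w w y)"
proof -
  have eq: "nbw E (Suc (Suc m)) x y y x = (\<Sum>w\<in>UNIV. \<Sum>s\<in>UNIV.
      (adj E x y * (of_bool (w \<noteq> x) * of_bool (s \<noteq> x))) * nbw E m y w s y)" for x y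
  proof -
    have "nbw E (Suc (Suc m)) x y y x = adj E x y * (\<Sum>w\<in>UNIV. of_bool (w \<noteq> x) *
        (adj E y x * (\<Sum>s\<in>UNIV. of_bool (s \<noteq> x) * nbw E m y w s y)))"
      unfolding nbw.simps(2)[of E "Suc m"] unfolding nbw_Suc_right ..
    also have "\<dots> = (\<Sum>w\<in>UNIV. \<Sum>s\<in>UNIV.
      (adj E x y * (of_bool (w \<noteq> x) * of_bool (s \<noteq> x))) * nbw E m y w s y)"
      unfolding sum_distrib_left by (intro sum.cong) (auto simp: insert_commute)
    finally show ?thesis .
  qed
  have count: "(\<Sum>x\<in>UNIV. (adj E x y * (of_bool (w \<noteq> x) * of_bool (s \<noteq> x))) * nbw E m y w s y)
     = (real (vertex_degree E y) - 2) * nbw E m y w s y + of_bool (w = s) * nbw E m y w s y" for y w s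
  proof (cases "{y, w} \<in> E \<and> {s, y} \<in> E")
    case True
    then have "{y, w} \<in> E" "{y, s} \<in> E" by (auto simp: insert_commute)
    from sum_neq2_adj[OF assms this] show ?thesis
      by (simp only: distrib_right flip: sum_distrib_right)
  next
    case False
    then have "nbw E m y w s y = 0"
      using adj_mult_nbw[where s = s and t = y and x = y and y = w and m = m and E = E] adj_mult_nbw_right[where s = s and t = y and x = y and y = w and m = m and E = E] by auto
    then show ?thesis by simp
  qed
  have "(\<Sum>x\<in>UNIV. \<Sum>y\<in>UNIV. nbw E (Suc (Suc m)) x y y x)
     = (\<Sum>y\<in>UNIV. \<Sum>w\<in>UNIV. \<Sum>s\<in>UNIV. \<Sum>x\<in>UNIV.
        (adj E x y * (of_bool (w \<noteq> x) * of_bool (s \<noteq> x))) * nbw E m y w s y)"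
    unfolding eq by (subst sum.swap, rule sum.cong[OF refl], subst sum.swap, rule sum.cong[OF refl], rule sum.swap)
  also have "\<dots> = (\<Sum>y\<in>UNIV. (real (vertex_degree E y) - 2) * geo E (Suc m) y y
      + (\<Sum>w\<in>UNIV. \<Sum>s\<in>UNIV. of_bool (w = s) * nbw E m y w s y))"
    unfolding count by (simp add: sum.distrib sum_distrib_left)
  \<comment> \<open>The terms with \<open>w = s\<close> are those whose stripped loop has a tail
    again.\<close>
  also have "\<dots> = (\<Sum>y\<in>UNIV. (real (vertex_degree E y) - 2) * geo E (Suc m) y y
      + (\<Sum>w\<in>UNIV. nbw E m y w w y))"
    by (simp only: sum_of_bool_eq_mult)
  finally show ?thesis by (simp only: sum.distrib)
qed

text \<open>Between \<open>closed_nb_Suc\<close> and \<open>tail_rec\<close> the counts of loops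
  with a tail cancel, leaving weighted traces only.\<close>

lemma closed_nb_rec:
  assumes "simple_graph E"
  shows "closed_nb E (Suc (Suc m)) - closed_nb E m = (\<Sum>x\<in>UNIV. geo E (Suc (Suc m)) x x)
    - of_bool (m \<noteq> 0) * (\<Sum>x\<in>UNIV. (real (vertex_degree E x) - 1) * geo E m x x)"
proof (cases m)
  case 0
  \<comment> \<open>A two-step loop would backtrack at its middle vertex.\<close>
  have "nbw E (Suc 0) x y y x = 0" for x y
    by (auto intro!: sum.neutral)
  then show ?thesis
    using 0 closed_nb_Suc[of E "Suc 0"] by (simp add: closed_nb_def del: nbw.simps geo.simps)
next
  case (Suc k)
  show ?thesis
    unfolding Suc closed_nb_Suc tail_rec[OF assms]
    by (simp add: left_diff_distrib sum_subtractf del: nbw.simps geo.simps flip: sum_distrib_left)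
qed

subsection \<open>Walks and loops as lists of vertices\<close>

definition nb_walk :: "'v set set \<Rightarrow> 'v list \<Rightarrow> bool" where
  "nb_walk E zs \<longleftrightarrow> (\<forall>i. Suc i < length zs \<longrightarrow> {zs ! i, zs ! Suc i} \<in> E) \<and>
    (\<forall>i. Suc (Suc i) < length zs \<longrightarrow> zs ! i \<noteq> zs ! Suc (Suc i))"

lemma nb_walk_Cons:
  "nb_walk E (x # y # zs) \<longleftrightarrow> {x, y} \<in> E \<and> nb_walk E (y # zs) \<and> (zs \<noteq> [] \<longrightarrow> zs ! 0 \<noteq> x)"
proof -
  have all: "(\<forall>i. P i) \<longleftrightarrow> P 0 \<and> (\<forall>i. P (Suc i))" for P :: "nat \<Rightarrow> bool"
    by (metis nat.exhaust)
  show ?thesis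
    unfolding nb_walk_def
    by (subst all, subst (2) all) auto
qed

text \<open>The lists counted by \<open>nbw\<close>: \<open>m + 1\<close> edges need
  \<open>m + 2\<close> vertices. For \<open>m = 0\<close> the first and last edges coincide.\<close>

definition nb_walks :: "'v set set \<Rightarrow> nat \<Rightarrow> 'v \<Rightarrow> 'v \<Rightarrow> 'v \<Rightarrow> 'v \<Rightarrow> 'v list set" where
  "nb_walks E m x y s t = {zs. length zs = Suc (Suc m) \<and> nb_walk E zs \<and>
    zs ! 0 = x \<and> zs ! 1 = y \<and> zs ! m = s \<and> zs ! Suc m = t}"

lemma finite_nb_walks [simp]: "finite (nb_walks E m x y s t)"
  for x :: "'v::finite"
  by (rule finite_subset[OF _ finite_lists_length_eq[of "UNIV :: 'v set" "Suc (Suc m)"]])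
    (auto simp: nb_walks_def)

lemma nb_walks_0: "nb_walks E 0 x y s t = (if {x, y} \<in> E \<and> x = s \<and> y = t then {[x, y]} else {})"
  by (auto simp: nb_walks_def nb_walk_def length_Suc_conv)

lemma nb_walks_Suc:
  fixes x :: 'v
  shows "nb_walks E (Suc m) x y s t
    = (if {x, y} \<in> E then Cons x ` (\<Union>w\<in>{w. w \<noteq> x}. nb_walks E m y w s t) else {})"
proof (rule set_eqI)
  fix zs :: "'v list"
  consider "length zs \<noteq> Suc (Suc (Suc m))"
    | a b c us where "zs = a # b # c # us" "length us = m"
    by (metis length_Suc_conv)
  then show "zs \<in> nb_walks E (Suc m) x y s t \<longleftrightarrow> zs \<in> (if {x, y} \<in> E
      then Cons x ` (\<Union>w\<in>{w. w \<noteq> x}. nb_walks E m y w s t) else {})"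
  proof cases
    case 2
    then show ?thesis
      by (auto simp: nb_walks_def nb_walk_Cons)
  qed (auto simp: nb_walks_def)
qed

text \<open>The vertex \<open>w\<close> can be read off the list, so the union over \<open>w\<close>
  is disjoint and the recursion for sets becomes that of \<open>nbw\<close>.\<close>

lemma card_nb_walks: "real (card (nb_walks E m x y s t)) = nbw E m x y s t"
proof (induction m arbitrary: x y)
  case 0
  then show ?case by (auto simp: nb_walks_0)
next
  case (Suc m)
  have "card (Cons x ` (\<Union>w\<in>{w. w \<noteq> x}. nb_walks E m y w s t))
      = (\<Sum>w\<in>{w. w \<noteq> x}. card (nb_walks E m y w s t))"
    by (subst card_image, simp, subst card_UN_disjoint, simp, simp)
      (auto simp: nb_walks_def)
  then show ?case
    by (auto simp: nb_walks_Suc Suc.IH sum_of_bool_mult_eq)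
qed

text \<open>The periodic extension of a list. Conditions that wrap around at the base point become
  conditions on all indices, which are visibly stable under rotation and powers.\<close>

definition cyc :: "'a list \<Rightarrow> nat \<Rightarrow> 'a" where
  "cyc xs i = xs ! (i mod length xs)"

lemma cyc_mod [simp]: "cyc xs (i mod length xs) = cyc xs i"
  by (simp add: cyc_def)

lemma cyc_nth: "i < length xs \<Longrightarrow> cyc xs i = xs ! i"
  by (simp add: cyc_def)

lemma cyc_Suc_mod [simp]: "cyc xs (Suc (i mod length xs)) = cyc xs (Suc i)"
  by (simp add: cyc_def mod_Suc_eq)

lemma cyc_Suc_Suc_mod [simp]: "cyc xs (Suc (Suc (i mod length xs))) = cyc xs (Suc (Suc i))"
  by (simp add: cyc_def) (metis mod_Suc_eq)

lemma based_loop_cyc: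
  "based_loop E xs \<longleftrightarrow> xs \<noteq> [] \<and> (\<forall>i. {cyc xs i, cyc xs (Suc i)} \<in> E)"
proof (cases "xs = []")
  case False
  have "(\<forall>i<length xs. {xs ! i, xs ! (Suc i mod length xs)} \<in> E)
      \<longleftrightarrow> (\<forall>i<length xs. {cyc xs i, cyc xs (Suc i)} \<in> E)"
    by (simp add: cyc_def)
  also have "\<dots> \<longleftrightarrow> (\<forall>i. {cyc xs i, cyc xs (Suc i)} \<in> E)"
    using False by (metis cyc_Suc_mod cyc_mod length_greater_0_conv mod_less_divisor)
  finally show ?thesis using False by (simp add: based_loop_def)
qed (simp add: based_loop_def)

lemma tailless_cyc:
  assumes "xs \<noteq> []"
  shows "tailless xs \<longleftrightarrow> (\<forall>i. cyc xs i \<noteq> cyc xs (Suc (Suc i)))"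
proof
  assume *: "tailless xs"
  show "\<forall>i. cyc xs i \<noteq> cyc xs (Suc (Suc i))"
  proof
    fix i
    \<comment> \<open>\<open>tailless\<close> is stated at the middle of three consecutive vertices,
      the periodic form at the first; hence the shift by one.\<close>
    let ?j = "Suc i mod length xs"
    have "?j < length xs" using assms by simp
    with * have "xs ! ((?j + length xs - 1) mod length xs) \<noteq> xs ! (Suc ?j mod length xs)"
      unfolding tailless_def by blast
    moreover have "(?j + length xs - 1) mod length xs = i mod length xs"
    proof -
      have "?j + length xs - 1 = ?j + (length xs - 1)" using assms by (cases xs) auto
      then have "(?j + length xs - 1) mod length xs = (Suc i + (length xs - 1)) mod length xs"
        by (simp only: mod_add_left_eq)
      also have "Suc i + (length xs - 1) = i + length xs" using assms by (cases xs) auto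
      finally show ?thesis by simp
    qed
    ultimately show "cyc xs i \<noteq> cyc xs (Suc (Suc i))"
      by (simp add: cyc_def mod_Suc_eq)
  qed
next
  assume *: "\<forall>i. cyc xs i \<noteq> cyc xs (Suc (Suc i))"
  show "tailless xs"
    unfolding tailless_def
  proof (intro allI impI)
    fix i assume "i < length xs"
    have "cyc xs (i + length xs - 1) \<noteq> cyc xs (Suc (Suc (i + length xs - 1)))"
      using * by blast
    moreover have "Suc (Suc (i + length xs - 1)) = Suc i + length xs"
      using assms by (cases xs) auto
    ultimately show "xs ! ((i + length xs - 1) mod length xs) \<noteq> xs ! (Suc i mod length xs)"
      by (simp only: cyc_def mod_add_self2) simp
  qed
qed

lemma geodesic_based_loop_cyc:
  "geodesic_based_loop E xs \<longleftrightarrow> based_loop E xs \<and>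
    (\<forall>i. Suc i < length xs \<longrightarrow> cyc xs i \<noteq> cyc xs (Suc (Suc i)))"
proof -
  have "(\<forall>i. 1 \<le> i \<and> i < length xs \<longrightarrow> xs ! (i - 1) \<noteq> xs ! (Suc i mod length xs))
    \<longleftrightarrow> (\<forall>i. Suc i < length xs \<longrightarrow> xs ! i \<noteq> xs ! (Suc (Suc i) mod length xs))"
    by (metis One_nat_def Suc_diff_Suc diff_Suc_1 diff_zero le_add1 less_eq_Suc_le plus_1_eq_Suc)
  then show ?thesis
    by (simp add: geodesic_based_loop_def cyc_def)
qed

section \<open>Loop counts as counts of closed walks\<close>

definition cycles :: "'v set set \<Rightarrow> 'v list set" where
  "cycles E = {xs. geodesic_based_loop E xs \<and> tailless xs}"

lemma cycles_cyc: "xs \<in> cycles E \<longleftrightarrow> xs \<noteq> [] \<and>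
    (\<forall>i. {cyc xs i, cyc xs (Suc i)} \<in> E \<and> cyc xs i \<noteq> cyc xs (Suc (Suc i)))"
  by (auto simp: cycles_def geodesic_based_loop_cyc based_loop_cyc tailless_cyc)

text \<open>Appending the base point turns a loop of length \<open>m + 1\<close> into a walk with as
  many edges. Backtracking is excluded at inner vertices of the walk only, so it stays allowed at
  the base point.\<close>

lemma num_geodesic_based_loops_Suc:
  fixes E :: "'v::finite set set"
  shows "real (num_geodesic_based_loops E (Suc m)) = (\<Sum>x\<in>UNIV. geo E (Suc m) x x)"
proof -
  let ?L = "{xs. geodesic_based_loop E xs \<and> length xs = Suc m}"
  let ?W = "\<lambda>(x, y, s). nb_walks E m x y s x"
  have nth: "(xs @ [xs ! 0]) ! i = cyc xs i" if "length xs = Suc m" "i \<le> Suc m" for xs :: "'v list" and i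
    using that by (auto simp: nth_append cyc_def)
  have walk: "nb_walk E (xs @ [xs ! 0]) \<longleftrightarrow> geodesic_based_loop E xs"
    if len: "length xs = Suc m" for xs :: "'v list"
  proof -
    have "nb_walk E (xs @ [xs ! 0]) \<longleftrightarrow> (\<forall>i<Suc m. {cyc xs i, cyc xs (Suc i)} \<in> E) \<and>
      (\<forall>i. Suc i < length xs \<longrightarrow> cyc xs i \<noteq> cyc xs (Suc (Suc i)))"
      using len by (simp add: nb_walk_def nth)
    then show ?thesis
      using len by (auto simp: geodesic_based_loop_cyc based_loop_def cyc_nth) (auto simp: cyc_def)
  qed
  have "bij_betw (\<lambda>xs. xs @ [xs ! 0]) ?L (\<Union>(range ?W))"
  proof (rule bij_betw_byWitness[where f' = butlast])
    show "(\<lambda>xs. xs @ [xs ! 0]) ` ?L \<subseteq> \<Union>(range ?W)"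
    proof safe
      fix xs assume "geodesic_based_loop E xs" "length xs = Suc m"
      then have "xs @ [xs ! 0] \<in> nb_walks E m (cyc xs 0) (cyc xs 1) (cyc xs m) (cyc xs 0)"
        using nth[of xs 0] nth[of xs 1] nth[of xs m] nth[of xs "Suc m"]
        by (auto simp: nb_walks_def walk) (auto simp: cyc_def)
      then show "xs @ [xs ! 0] \<in> \<Union>(range ?W)" by auto
    qed
    have closed: "zs = butlast zs @ [butlast zs ! 0] \<and> length (butlast zs) = Suc m"
      if "zs \<in> nb_walks E m x y s x" for zs :: "'v list" and x y s
    proof -
      obtain ys z where "zs = ys @ [z]"
        using \<open>zs \<in> _\<close> by (cases zs rule: rev_cases) (auto simp: nb_walks_def)
      then show ?thesis
        using that by (cases ys) (auto simp: nb_walks_def)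
    qed
    then show "\<forall>zs\<in>\<Union>(range ?W). butlast zs @ [butlast zs ! 0] = zs"
      by fastforce
    show "butlast ` \<Union>(range ?W) \<subseteq> ?L"
    proof safe
      fix zs x y s assume zs: "zs \<in> nb_walks E m x y s x"
      then show "length (butlast zs) = Suc m" using closed by blast
      moreover have "nb_walk E (butlast zs @ [butlast zs ! 0])"
        using closed[OF zs] zs by (simp add: nb_walks_def)
      ultimately show "geodesic_based_loop E (butlast zs)" by (simp add: walk)
    qed
  qed simp
  then have "card ?L = card (\<Union>(range ?W))" by (rule bij_betw_same_card)
  also have "\<dots> = (\<Sum>a\<in>UNIV. card (?W a))"
    by (rule card_UN_disjoint, simp, force) (auto simp: nb_walks_def)
  finally have "real (card ?L) = (\<Sum>(x, y, s)\<in>UNIV. nbw E m x y s x)"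
    by (simp add: card_nb_walks case_prod_beta)
  then show ?thesis
    by (simp add: num_geodesic_based_loops_def sum.cartesian_product)
qed

text \<open>Appending the first two vertices also imposes the conditions at the base point. Lengths
  0 and 1 are separate, since \<open>xs ! Suc 0\<close> requires two vertices; length 1 would need a
  self-loop.\<close>

lemma card_cycles:
  fixes E :: "'v::finite set set"
  assumes "simple_graph E"
  shows "real (card {xs \<in> cycles E. length xs = m}) = closed_nb E m"
proof -
  consider "m = 0" | "m = 1" | "2 \<le> m" by linarith
  then show ?thesis
  proof cases
    case 1
    then show ?thesis by (auto simp: cycles_cyc closed_nb_def)
  next
    case 2
    have "xs \<notin> cycles E" if "length xs = 1" for xs :: "'v list"
      using that simple_graph_irrefl[OF assms] by (auto simp: cycles_cyc cyc_def)
    then have empty: "{xs \<in> cycles E. length xs = m} = {}" using 2 by auto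
    have "nbw E (Suc 0) x y x y = 0" for x y
      by (auto intro!: sum.neutral)
    then have "closed_nb E m = 0"
      using 2 by (simp add: closed_nb_def del: nbw.simps)
    then show ?thesis by (simp only: empty) simp
  next
    case 3
    let ?L = "{xs \<in> cycles E. length xs = m}"
    let ?W = "\<lambda>(x, y). nb_walks E m x y x y"
    let ?f = "\<lambda>xs. xs @ [xs ! 0, xs ! Suc 0]"
    have nth: "?f xs ! i = cyc xs i" if "length xs = m" "i \<le> Suc m" for xs :: "'v list" and i
    proof -
      consider "i < m" | "i = m" | "i = Suc m" using \<open>i \<le> Suc m\<close> by linarith
      then show ?thesis
        by cases (use that 3 in \<open>auto simp: nth_append cyc_def mod_Suc\<close>)
    qed
    have walk: "nb_walk E (?f xs) \<longleftrightarrow> xs \<in> cycles E" if len: "length xs = m" for xs :: "'v list"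
    proof -
      have "nb_walk E (?f xs) \<longleftrightarrow> (\<forall>i<Suc m. {cyc xs i, cyc xs (Suc i)} \<in> E) \<and>
        (\<forall>i<m. cyc xs i \<noteq> cyc xs (Suc (Suc i)))"
        using len by (simp add: nb_walk_def nth)
      also have "\<dots> \<longleftrightarrow> (\<forall>i. {cyc xs i, cyc xs (Suc i)} \<in> E \<and> cyc xs i \<noteq> cyc xs (Suc (Suc i)))"
      proof (intro iffI allI)
        fix i
        assume *: "(\<forall>i<Suc m. {cyc xs i, cyc xs (Suc i)} \<in> E) \<and>
          (\<forall>i<m. cyc xs i \<noteq> cyc xs (Suc (Suc i)))"
        \<comment> \<open>Reduction modulo \<open>m\<close> moves any index into the one period
          covered by the prolonged list.\<close>
        have "i mod m < m" "i mod m < Suc m" using 3 by (simp_all add: less_SucI)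
        with * have "{cyc xs (i mod m), cyc xs (Suc (i mod m))} \<in> E"
          "cyc xs (i mod m) \<noteq> cyc xs (Suc (Suc (i mod m)))" by blast+
        then show "{cyc xs i, cyc xs (Suc i)} \<in> E \<and> cyc xs i \<noteq> cyc xs (Suc (Suc i))"
          by (simp add: len[symmetric])
      qed auto
      finally show ?thesis using len 3 by (auto simp: cycles_cyc)
    qed
    have "bij_betw ?f ?L (\<Union>(range ?W))"
    proof (rule bij_betw_byWitness[where f' = "take m"])
      show "?f ` ?L \<subseteq> \<Union>(range ?W)"
      proof (rule image_subsetI)
        fix xs assume "xs \<in> ?L"
        then have xs: "xs \<in> cycles E" "length xs = m" by auto
        have wrap: "cyc xs m = cyc xs 0" "cyc xs (Suc m) = cyc xs 1"
          using xs(2) by (simp_all add: cyc_def mod_Suc)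
        have "length (?f xs) = Suc (Suc m)" "1 \<le> Suc m" "m \<le> Suc m" using xs(2) by simp_all
        note this(1) nth[OF xs(2) le0] nth[OF xs(2) this(2)] nth[OF xs(2) this(3)]
          nth[OF xs(2) order_refl]
        then have "?f xs \<in> nb_walks E m (cyc xs 0) (cyc xs 1) (cyc xs 0) (cyc xs 1)"
          by (simp only: nb_walks_def mem_Collect_eq walk[OF xs(2)] xs wrap simp_thms)
        then show "?f xs \<in> \<Union>(range ?W)" by auto
      qed
      have closed: "zs = ?f (take m zs) \<and> length (take m zs) = m"
        if "zs \<in> nb_walks E m x y x y" for zs :: "'v list" and x y
      proof -
        have len: "length zs = Suc (Suc m)" and "zs ! m = zs ! 0" "zs ! Suc m = zs ! 1"
          using that by (auto simp: nb_walks_def)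
        then have "zs = take m zs @ [zs ! m, zs ! Suc m]"
          by (metis append_Cons append_Nil append_assoc lessI less_SucI take_Suc_conv_app_nth take_all_iff order_refl)
        then show ?thesis using len 3 \<open>zs ! m = zs ! 0\<close> \<open>zs ! Suc m = zs ! 1\<close> by simp
      qed
      then show "\<forall>zs\<in>\<Union>(range ?W). ?f (take m zs) = zs"
        by fastforce
      show "take m ` \<Union>(range ?W) \<subseteq> ?L"
      proof safe
        fix zs x y assume zs: "zs \<in> nb_walks E m x y x y"
        then show "length (take m zs) = m" using closed by blast
        moreover have "nb_walk E (?f (take m zs))"
          using closed[OF zs] zs by (simp add: nb_walks_def)
        ultimately show "take m zs \<in> cycles E" using walk by blast
      qed
    qed auto
    then have "card ?L = card (\<Union>(range ?W))" by (rule bij_betw_same_card)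
    also have "\<dots> = (\<Sum>a\<in>UNIV. card (?W a))"
      by (rule card_UN_disjoint, simp, force) (auto simp: nb_walks_def)
    finally have "real (card ?L) = (\<Sum>(x, y)\<in>UNIV. nbw E m x y x y)"
      by (simp add: card_nb_walks case_prod_beta)
    then show ?thesis
      using 3 by (simp add: closed_nb_def sum.cartesian_product)
  qed
qed

subsection \<open>Primitive loops and the Euler product\<close>

abbreviation list_pow :: "nat \<Rightarrow> 'a list \<Rightarrow> 'a list" where
  "list_pow n ys \<equiv> concat (replicate n ys)"

lemma length_list_pow: "length (list_pow n ys) = n * length ys"
  by (induction n) auto

lemma nth_list_pow: "i < n * length ys \<Longrightarrow> list_pow n ys ! i = cyc ys i"
proof (induction n arbitrary: i)
  case (Suc n)
  show ?case
  proof (cases "i < length ys")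
    case False
    then have "i - length ys < n * length ys" using Suc.prems by auto
    then have "list_pow n ys ! (i - length ys) = cyc ys (i - length ys)" by (rule Suc.IH)
    then show ?thesis using False by (simp add: nth_append cyc_def le_mod_geq)
  qed (simp add: nth_append cyc_nth)
qed simp

lemma cyc_list_pow:
  assumes "0 < n" shows "cyc (list_pow n ys) i = cyc ys i"
proof (cases "ys = []")
  case False
  then have "i mod (n * length ys) < n * length ys" using assms by simp
  then have "cyc (list_pow n ys) i = cyc ys (i mod (n * length ys))"
    by (simp add: cyc_def[of "list_pow n ys"] length_list_pow nth_list_pow)
  then show ?thesis by (simp add: cyc_def mod_mod_cancel)
qed (simp add: cyc_def)

lemma list_pow_eq_Nil_iff: "list_pow n ys = [] \<longleftrightarrow> n = 0 \<or> ys = []"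
  by (cases n) auto

lemma list_pow_list_pow: "list_pow m (list_pow n ys) = list_pow (m * n) ys"
  by (induction m) (auto simp: replicate_add)

lemma rotate1_list_pow: "rotate1 (list_pow n ys) = list_pow n (rotate1 ys)"
proof (cases ys)
  case (Cons y zs)
  have "concat (replicate n (y # zs)) @ [y] = y # concat (replicate n (zs @ [y]))"
    by (induction n) auto
  then show ?thesis using Cons
    by (cases n) auto
qed (induction n, auto)

lemma rotate_list_pow: "rotate k (list_pow n ys) = list_pow n (rotate k ys)"
  by (induction k) (auto simp: rotate1_list_pow)

lemma cyc_rotate: "xs \<noteq> [] \<Longrightarrow> cyc (rotate k xs) i = cyc xs (k + i)"
  by (simp add: cyc_def nth_rotate mod_add_right_eq)

text \<open>The exponent complements \<open>k\<close> to a multiple of the length; for nonempty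
  lists the subtraction is not truncated.\<close>

lemma rotate_inverse: "rotate (length xs * k - k) (rotate k xs) = xs"
proof (cases xs)
  case (Cons y ys)
  then have "length xs * k - k + k = length xs * k" by simp
  then show ?thesis by (simp add: rotate_rotate)
qed simp

lemma inj_rotate: "rotate k xs = rotate k ys \<Longrightarrow> xs = ys"
  by (induction k) (auto dest: injD[OF inj_rotate1])

lemma rotate_cycles_iff [simp]: "rotate k xs \<in> cycles E \<longleftrightarrow> xs \<in> cycles E"
proof -
  have *: "rotate k xs \<in> cycles E" if "xs \<in> cycles E" for xs k
    using that by (auto simp: cycles_cyc cyc_rotate)
  from *[of "rotate k xs" "length xs * k - k"] *[of xs k] show ?thesis
    by (auto simp: rotate_inverse)
qed

lemma list_pow_cycles_iff: "0 < n \<Longrightarrow> list_pow n ys \<in> cycles E \<longleftrightarrow> ys \<in> cycles E"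
  by (simp add: cycles_cyc cyc_list_pow list_pow_eq_Nil_iff)

text \<open>Combinatorial primitivity of a list, without reference to a graph;
  \<open>primitive_geodesic_loops_eq\<close> identifies it with primitivity of loops.\<close>

definition primitive_word :: "'a list \<Rightarrow> bool" where
  "primitive_word xs \<longleftrightarrow> xs \<noteq> [] \<and> \<not> (\<exists>n\<ge>2. \<exists>ys. xs = list_pow n ys)"

lemma ex_primitive_root:
  "xs \<noteq> [] \<Longrightarrow> \<exists>n ys. 0 < n \<and> primitive_word ys \<and> xs = list_pow n ys"
proof (induction xs rule: length_induct)
  case (1 xs)
  show ?case
  proof (cases "primitive_word xs")
    case True
    then show ?thesis by (intro exI[of _ 1] exI[of _ xs]) auto
  next
    case False
    with \<open>xs \<noteq> []\<close> obtain n ys where n: "2 \<le> n" "xs = list_pow n ys"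
      by (auto simp: primitive_word_def)
    with \<open>xs \<noteq> []\<close> have "ys \<noteq> []" by (auto simp: list_pow_eq_Nil_iff)
    with n have "length ys < length xs" by (simp add: length_list_pow)
    with \<open>ys \<noteq> []\<close> "1.IH" obtain m zs where "0 < m" "primitive_word zs" "ys = list_pow m zs"
      by blast
    then show ?thesis
      using n by (intro exI[of _ "n * m"] exI[of _ zs]) (auto simp: list_pow_list_pow)
  qed
qed

text \<open>If \<open>0 < r < |xs|\<close> is a rotational period of \<open>xs\<close> then the two blocks of
  \<open>xs\<close> cut at \<open>r\<close> commute, hence are powers of a common word.\<close>

lemma primitive_word_period:
  assumes "primitive_word xs" and "rotate k xs = xs"
  shows "length xs dvd k"
proof (rule ccontr)
  assume ndvd: "\<not> length xs dvd k"
  define r where "r = k mod length xs"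
  have "xs \<noteq> []" using assms by (simp add: primitive_word_def)
  then have r: "0 < r" "r < length xs"
    using ndvd by (auto simp: r_def dvd_eq_mod_eq_0)
  have "drop r xs @ take r xs = xs"
    using assms(2) r by (simp add: rotate_drop_take r_def)
  then have comm: "take r xs @ drop r xs = drop r xs @ take r xs" by simp
  obtain m n zs where zs: "list_pow m zs = take r xs" "list_pow n zs = drop r xs"
    using comm_append_are_replicate[OF comm] by blast
  then have "xs = list_pow (m + n) zs"
    by (metis append_take_drop_id concat_append replicate_add)
  \<comment> \<open>Neither block is empty, so both exponents are positive and \<open>xs\<close> is
    a proper power.\<close>
  moreover have "m \<noteq> 0" using zs(1) r by (intro notI) simp
  moreover have "n \<noteq> 0" using zs(2) r by (intro notI) simp
  ultimately have "2 \<le> m + n" "xs = list_pow (m + n) zs" by linarith+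
  then show False using assms(1) by (auto simp: primitive_word_def)
qed

text \<open>Rotation by the length of \<open>zs\<close> fixes the common power, hence fixes
  \<open>ys\<close>, so \<open>primitive_word_period\<close> makes the length of \<open>zs\<close> a
  multiple of that of \<open>ys\<close>. By symmetry the lengths agree, and both words are the first
  period of the power.\<close>

lemma primitive_root_unique:
  assumes "primitive_word ys" "primitive_word zs" "0 < m" "0 < n"
    and eq: "list_pow m ys = list_pow n zs"
  shows "ys = zs \<and> m = n"
proof -
  have dvd: "length ys dvd length zs"
    if "primitive_word ys" "0 < m" "0 < n" "list_pow m ys = list_pow n zs"
    for ys zs :: "'a list" and m n
  proof -
    have "list_pow m (rotate (length zs) ys) = list_pow n (rotate (length zs) zs)"
      by (simp only: that(4) flip: rotate_list_pow)
    then have eq: "list_pow m (rotate (length zs) ys) = list_pow m ys"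
      using that(4) by simp
    have "rotate (length zs) ys = ys"
    proof (rule nth_equalityI)
      fix i assume "i < length (rotate (length zs) ys)"
      then have i: "i < length ys" by simp
      then have "cyc (rotate (length zs) ys) i = cyc ys i"
        using eq \<open>0 < m\<close> by (metis cyc_list_pow)
      then show "rotate (length zs) ys ! i = ys ! i" using i by (simp add: cyc_nth)
    qed simp
    then show ?thesis using that(1) primitive_word_period by blast
  qed
  have len: "length ys = length zs"
    using dvd[OF assms(1,3,4) eq] dvd[OF assms(2,4,3) eq[symmetric]] by (rule dvd_antisym)
  moreover have "ys = zs"
  proof (rule nth_equalityI)
    fix i assume "i < length ys"
    moreover have "cyc ys i = cyc zs i" using eq assms(3,4) by (metis cyc_list_pow)
    ultimately show "ys ! i = zs ! i" using len by (simp add: cyc_nth)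
  qed (rule len)
  moreover have "m * length ys = n * length zs"
    using eq by (metis length_list_pow)
  ultimately show ?thesis using assms(1) by (auto simp: primitive_word_def)
qed

lemma primitive_word_rotate [simp]: "primitive_word (rotate k xs) \<longleftrightarrow> primitive_word xs"
proof -
  have *: "primitive_word (rotate k xs)" if "primitive_word xs" for k and xs :: "'a list"
    unfolding primitive_word_def
  proof safe
    fix n ys assume n: "2 \<le> n" and eq: "rotate k xs = list_pow n ys"
    have "xs = rotate (length xs * k - k) (rotate k xs)"
      by (simp only: rotate_inverse)
    also have "\<dots> = list_pow n (rotate (length xs * k - k) ys)"
      by (simp only: eq rotate_list_pow)
    finally show False using that n by (auto simp: primitive_word_def)
  qed (use that in \<open>simp add: primitive_word_def\<close>)
  from *[of "rotate k xs" "length xs * k - k"] *[of xs k] show ?thesis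
    by (auto simp: rotate_inverse)
qed

section \<open>Primitive roots and rotation classes of cycles\<close>

definition primitive_cycles :: "'v set set \<Rightarrow> 'v list set" where
  "primitive_cycles E = {xs \<in> cycles E. primitive_word xs}"

text \<open>Existence and uniqueness of the primitive root of a cycle; the exponent is
  \<open>Suc n\<close>, so that \<open>n\<close> ranges over all naturals.\<close>

lemma bij_betw_list_pow_cycles:
  "bij_betw (\<lambda>(ys, n). list_pow (Suc n) ys) (primitive_cycles E \<times> UNIV) (cycles E)"
  unfolding bij_betw_def
proof (intro conjI inj_onI set_eqI iffI)
  fix p q assume "p \<in> primitive_cycles E \<times> UNIV" "q \<in> primitive_cycles E \<times> UNIV"
    "(\<lambda>(ys, n). list_pow (Suc n) ys) p = (\<lambda>(ys, n). list_pow (Suc n) ys) q"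
  then show "p = q"
    using primitive_root_unique[of "fst p" "fst q" "Suc (snd p)" "Suc (snd q)"]
    by (auto simp: primitive_cycles_def prod_eq_iff case_prod_beta simp del: replicate.simps)
next
  fix xs assume "xs \<in> (\<lambda>(ys, n). list_pow (Suc n) ys) ` (primitive_cycles E \<times> UNIV)"
  then show "xs \<in> cycles E"
    by (auto simp: primitive_cycles_def list_pow_cycles_iff simp del: replicate.simps)
next
  fix xs assume xs: "xs \<in> cycles E"
  then have "xs \<noteq> []" by (simp add: cycles_cyc)
  then obtain n ys where n: "0 < n" "primitive_word ys" "xs = list_pow n ys"
    using ex_primitive_root by blast
  with xs have "(ys, n - 1) \<in> primitive_cycles E \<times> UNIV"
    by (simp add: primitive_cycles_def list_pow_cycles_iff)
  moreover have "xs = (\<lambda>(ys, n). list_pow (Suc n) ys) (ys, n - 1)" using n by (cases n) simp_all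
  ultimately show "xs \<in> (\<lambda>(ys, n). list_pow (Suc n) ys) ` (primitive_cycles E \<times> UNIV)"
    by (rule rev_image_eqI)
qed

lemma cyclic_shift_Image: "cyclic_shift `` {xs} = range (\<lambda>k. rotate k xs)"
  by (auto simp: cyclic_shift_def)

text \<open>A root of a cycle is itself a cycle, in particular a based loop, and rotation preserves
  primitivity. So primitivity of a class and of a representing word agree.\<close>

lemma primitive_geodesic_loops_eq:
  "primitive_geodesic_loops E = (\<lambda>xs. range (\<lambda>k. rotate k xs)) ` primitive_cycles E"
proof -
  have prim: "(\<forall>ys\<in>range (\<lambda>k. rotate k xs). \<not> (\<exists>n\<ge>2. \<exists>zs. based_loop E zs \<and> ys = list_pow n zs))
      \<longleftrightarrow> primitive_word xs" if "xs \<in> cycles E" for xs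
  proof -
    have "based_loop E zs" if "ys = list_pow n zs" "ys = rotate k xs" "2 \<le> n" for ys zs n k
    proof -
      have "list_pow n zs \<in> cycles E" using that \<open>xs \<in> cycles E\<close> by (metis rotate_cycles_iff)
      then have "zs \<in> cycles E" using list_pow_cycles_iff[of n zs E] \<open>2 \<le> n\<close> by simp
      then show ?thesis by (simp add: cycles_def geodesic_based_loop_def)
    qed
    note based = this
    show ?thesis
    proof
      assume L: "\<forall>ys\<in>range (\<lambda>k. rotate k xs). \<not> (\<exists>n\<ge>2. \<exists>zs. based_loop E zs \<and> ys = list_pow n zs)"
      have xs: "xs \<in> range (\<lambda>k. rotate k xs)" by (rule range_eqI[of _ _ 0]) simp
      have "\<not> (\<exists>n\<ge>2. \<exists>zs. xs = list_pow n zs)"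
      proof clarify
        fix n :: nat and zs assume "2 \<le> n" "xs = list_pow n zs"
        moreover from this have "based_loop E zs" using based[of xs n zs 0] by simp
        ultimately show False using L xs by blast
      qed
      then show "primitive_word xs"
        using \<open>xs \<in> cycles E\<close> by (simp add: primitive_word_def cycles_cyc)
    next
      assume "primitive_word xs"
      then have "primitive_word (rotate k xs)" for k by simp
      then show "\<forall>ys\<in>range (\<lambda>k. rotate k xs). \<not> (\<exists>n\<ge>2. \<exists>zs. based_loop E zs \<and> ys = list_pow n zs)"
        by (auto simp: primitive_word_def)
    qed
  qed
  have "geodesic_loops E = (\<lambda>xs. range (\<lambda>k. rotate k xs)) ` cycles E"
    by (auto simp: geodesic_loops_def quotient_def cyclic_shift_Image cycles_def)
  then show ?thesis
    using prim by (fastforce simp: primitive_geodesic_loops_def primitive_cycles_def)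
qed

lemma loop_length_range [simp]: "loop_length (range (\<lambda>k. rotate k xs)) = length xs"
proof -
  have "length ` range (\<lambda>k. rotate k xs) = {length xs}" by (simp add: image_image)
  then show ?thesis by (simp add: loop_length_def)
qed

text \<open>Two equal rotations by less than the length would give a period shorter than the length,
  against \<open>primitive_word_period\<close>. The orbit size later cancels the weight
  1/length.\<close>

lemma card_range_rotate:
  assumes "primitive_word xs"
  shows "card (range (\<lambda>k. rotate k xs)) = length xs"
proof -
  have ne: "xs \<noteq> []" using assms by (simp add: primitive_word_def)
  have "range (\<lambda>k. rotate k xs) = (\<lambda>k. rotate k xs) ` {..<length xs}"
  proof (intro equalityI subsetI)
    fix ys assume "ys \<in> range (\<lambda>k. rotate k xs)"
    then obtain k where "ys = rotate k xs" by auto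
    then have "ys = rotate (k mod length xs) xs" by (metis rotate_conv_mod)
    then show "ys \<in> (\<lambda>k. rotate k xs) ` {..<length xs}" using ne by auto
  qed auto
  moreover have "inj_on (\<lambda>k. rotate k xs) {..<length xs}"
  proof (rule linorder_inj_onI)
    fix i j assume ij: "i < j" "i \<in> {..<length xs}" "j \<in> {..<length xs}"
    show "rotate i xs \<noteq> rotate j xs"
    proof
      assume "rotate i xs = rotate j xs"
      also have "\<dots> = rotate i (rotate (j - i) xs)" using ij by (simp add: rotate_rotate)
      finally have "rotate (j - i) xs = xs" using inj_rotate by metis
      then have "length xs dvd j - i" by (rule primitive_word_period[OF assms])
      then show False using ij by (auto dest: dvd_imp_le)
    qed
  qed auto
  ultimately show ?thesis by (simp add: card_image)
qed

lemma range_rotate_eq: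
  assumes "ys \<in> range (\<lambda>k. rotate k xs)"
  shows "range (\<lambda>k. rotate k ys) = range (\<lambda>k. rotate k xs)"
proof -
  obtain k where k: "ys = rotate k xs" using assms by auto
  have "rotate (length xs * k - k) ys = xs"
    by (simp only: k rotate_inverse)
  then have "rotate l xs = rotate (l + (length xs * k - k)) ys" for l
    by (metis rotate_rotate)
  moreover have "rotate l ys = rotate (l + k) xs" for l
    by (simp only: k rotate_rotate)
  ultimately show ?thesis by (intro equalityI image_subsetI) (metis rangeI)+
qed

text \<open>The orbits partition the primitive cycles, so a sum over these can be regrouped by
  loops.\<close>

lemma bij_betw_primitive_cycles:
  "bij_betw snd (SIGMA \<gamma>:primitive_geodesic_loops E. \<gamma>) (primitive_cycles E)"
proof (rule bij_betw_byWitness[where f' = "\<lambda>xs. (range (\<lambda>k. rotate k xs), xs)"])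
  show "\<forall>p\<in>SIGMA \<gamma>:primitive_geodesic_loops E. \<gamma>. (range (\<lambda>k. rotate k (snd p)), snd p) = p"
  proof
    fix p assume "p \<in> (SIGMA \<gamma>:primitive_geodesic_loops E. \<gamma>)"
    then obtain xs where "fst p = range (\<lambda>k. rotate k xs)" "snd p \<in> fst p"
      by (cases p) (auto simp only: primitive_geodesic_loops_eq mem_Sigma_iff image_iff fst_conv snd_conv)
    then show "(range (\<lambda>k. rotate k (snd p)), snd p) = p"
      by (metis range_rotate_eq prod.collapse)
  qed
  have self: "xs \<in> range (\<lambda>k. rotate k xs)" for xs :: "'a list"
    by (rule range_eqI[of _ _ 0]) simp
  show "(\<lambda>xs. (range (\<lambda>k. rotate k xs), xs)) ` primitive_cycles E
      \<subseteq> (SIGMA \<gamma>:primitive_geodesic_loops E. \<gamma>)"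
    unfolding primitive_geodesic_loops_eq by (intro image_subsetI SigmaI imageI self)
  show "snd ` (SIGMA \<gamma>:primitive_geodesic_loops E. \<gamma>) \<subseteq> primitive_cycles E"
    by (auto simp: primitive_geodesic_loops_eq primitive_cycles_def)
qed simp

text \<open>Group the cycles by primitive root and exponent. For a root of length \<open>p\<close>
  the exponents contribute \<open>- ln (1 - u ^ p) / p\<close>, by the logarithm series; then the
  \<open>p\<close> rotations of the root cancel the denominator.\<close>

lemma has_sum_log_ihara_factor:
  assumes u: "0 < u" "u < 1"
    and S: "((\<lambda>xs. u ^ length xs / length xs) has_sum S) (cycles E)"
  shows "((\<lambda>\<gamma>. ln (ihara_factor u \<gamma>)) has_sum S) (primitive_geodesic_loops E)"
proof -
  let ?g = "\<lambda>\<gamma> n. u ^ (Suc n * loop_length \<gamma>) / (Suc n * loop_length \<gamma>)"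
  have inner: "((\<lambda>n. u ^ (Suc n * length xs) / (Suc n * length xs)) has_sum
      (- ln (1 - u ^ length xs) / length xs)) UNIV" if "xs \<noteq> []" for xs :: "'a list"
  proof -
    let ?v = "u ^ length xs"
    have v: "0 < ?v" "?v < 1" using u that by (auto simp: power_less_one_iff)
    have "(\<lambda>n. - (?v ^ n / of_nat n)) sums ln (1 - ?v)"
      using ln_series'[of "- ?v"] v by simp
    then have "(\<lambda>n. ?v ^ n / of_nat n) sums (- ln (1 - ?v))"
      using sums_minus by fastforce
    then have "(\<lambda>n. ?v ^ Suc n / of_nat (Suc n)) sums (- ln (1 - ?v))"
      by (subst sums_Suc_iff) simp
    then have "(\<lambda>n. ?v ^ Suc n / of_nat (Suc n) / length xs) sums (- ln (1 - ?v) / length xs)"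
      by (rule sums_divide)
    then have "(\<lambda>n. u ^ (Suc n * length xs) / (Suc n * length xs)) sums (- ln (1 - ?v) / length xs)"
      by (simp only: mult.commute[of _ "length xs"] power_mult divide_divide_eq_left' of_nat_mult)
    \<comment> \<open>Nonnegative terms make the ordered series an unordered sum.\<close>
    then show ?thesis
      by (rule sums_nonneg_imp_has_sum) (use u in auto)
  qed
  have "((\<lambda>p. u ^ length (case p of (ys, n) \<Rightarrow> list_pow (Suc n) ys)
      / length (case p of (ys, n) \<Rightarrow> list_pow (Suc n) ys)) has_sum S) (primitive_cycles E \<times> UNIV)"
    using has_sum_reindex_bij_betw[OF bij_betw_list_pow_cycles[of E],
        of "\<lambda>xs. u ^ length xs / length xs" S] S by simp
  then have "((\<lambda>(ys, n). u ^ (Suc n * length ys) / (Suc n * length ys)) has_sum S)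
      (Sigma (primitive_cycles E) (\<lambda>_. UNIV))"
    by (simp only: case_prod_unfold length_list_pow)
  then have "((\<lambda>xs. - ln (1 - u ^ length xs) / length xs) has_sum S) (primitive_cycles E)"
  proof (rule has_sum_SigmaD)
    fix xs assume "xs \<in> primitive_cycles E"
    then have "xs \<noteq> []" by (simp add: primitive_cycles_def cycles_cyc)
    from inner[OF this] show "((\<lambda>n. case (xs, n) of (ys, n) \<Rightarrow> u ^ (Suc n * length ys) / (Suc n * length ys))
        has_sum - ln (1 - u ^ length xs) / length xs) UNIV"
      by (simp only: prod.case)
  qed
  then have "((\<lambda>p. - ln (1 - u ^ length (snd p)) / length (snd p)) has_sum S)
      (Sigma (primitive_geodesic_loops E) (\<lambda>\<gamma>. \<gamma>))"
    by (subst has_sum_reindex_bij_betw[OF bij_betw_primitive_cycles[of E]])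
  then have "((\<lambda>(\<gamma>, xs). - ln (1 - u ^ length xs) / length xs) has_sum S)
      (Sigma (primitive_geodesic_loops E) (\<lambda>\<gamma>. \<gamma>))"
    by (simp only: case_prod_unfold)
  then show ?thesis
  proof (rule has_sum_SigmaD)
    fix \<gamma> assume "\<gamma> \<in> primitive_geodesic_loops E"
    then obtain xs where xs: "xs \<in> primitive_cycles E" "\<gamma> = range (\<lambda>k. rotate k xs)"
      by (auto simp: primitive_geodesic_loops_eq)
    then have card: "card \<gamma> = length xs" and ne: "xs \<noteq> []"
      by (auto simp: primitive_cycles_def card_range_rotate cycles_cyc)
    then have fin: "finite \<gamma>" using card_ge_0_finite[of \<gamma>] by simp
    have "((\<lambda>ys. - ln (1 - u ^ length ys) / length ys) has_sum
        (\<Sum>ys\<in>\<gamma>. - ln (1 - u ^ length ys) / length ys)) \<gamma>"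
      by (rule has_sum_finite[OF fin])
    also have "(\<Sum>ys\<in>\<gamma>. - ln (1 - u ^ length ys) / length ys)
        = (\<Sum>ys\<in>\<gamma>. - ln (1 - u ^ length xs) / length xs)"
      by (intro sum.cong) (auto simp: xs)
    also have "\<dots> = ln (ihara_factor u \<gamma>)"
      using card ne xs(2) by (simp add: ihara_factor_def ln_inverse power_less_one_iff u)
    finally show "((\<lambda>ys. case (\<gamma>, ys) of (\<gamma>, xs) \<Rightarrow> - ln (1 - u ^ length xs) / length xs)
        has_sum ln (ihara_factor u \<gamma>)) \<gamma>"
      by (simp only: prod.case)
  qed
qed

text \<open>The factors are positive, so a finite product is the exponential of the sum of
  logarithms, and continuity of \<open>exp\<close> gives the limit.\<close>

lemma tendsto_prod_ihara_factor:
  assumes u: "0 < u" "u < 1"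
    and S: "((\<lambda>xs. u ^ length xs / length xs) has_sum S) (cycles E)"
  shows "(prod (ihara_factor u) \<longlongrightarrow> exp S) (finite_subsets_at_top (primitive_geodesic_loops E))"
proof -
  have "((\<lambda>F. exp (\<Sum>\<gamma>\<in>F. ln (ihara_factor u \<gamma>))) \<longlongrightarrow> exp S)
      (finite_subsets_at_top (primitive_geodesic_loops E))"
    using has_sum_log_ihara_factor[OF assms] unfolding has_sum_def by (rule tendsto_exp)
  moreover have "\<forall>\<^sub>F F in finite_subsets_at_top (primitive_geodesic_loops E).
      exp (\<Sum>\<gamma>\<in>F. ln (ihara_factor u \<gamma>)) = prod (ihara_factor u) F"
  proof (rule eventually_finite_subsets_at_top_weakI)
    fix F assume F: "finite F" "F \<subseteq> primitive_geodesic_loops E"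
    have "0 < ihara_factor u \<gamma>" if \<gamma>: "\<gamma> \<in> F" for \<gamma>
    proof -
      obtain xs where "xs \<noteq> []" "\<gamma> = range (\<lambda>k. rotate k xs)"
        using \<gamma> F(2) by (auto simp: primitive_geodesic_loops_eq primitive_cycles_def cycles_cyc)
      then show ?thesis using u by (simp add: ihara_factor_def power_less_one_iff)
    qed
    then show "exp (\<Sum>\<gamma>\<in>F. ln (ihara_factor u \<gamma>)) = prod (ihara_factor u) F"
      using F by (simp add: exp_sum)
  qed
  ultimately show ?thesis by (rule Lim_transform_eventually)
qed

subsection \<open>Generating functions and the determinant formula\<close>

text \<open>Each term of the product rule omits one factor of a Leibniz product. A permutation other
  than the identity moves at least two points, so one remaining factor is an off-diagonal zero of
  \<open>B z\<close>.\<close>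

lemma det_has_field_derivative_at_identity:
  fixes B :: "real \<Rightarrow> real^'n^'n"
  assumes deriv: "\<And>i j. ((\<lambda>t. B t $ i $ j) has_field_derivative B' $ i $ j) (at z)"
    and "B z = mat 1"
  shows "((\<lambda>t. det (B t)) has_field_derivative trace B') (at z)"
proof -
  let ?P = "{p. p permutes (UNIV :: 'n set)}"
  let ?d = "\<lambda>p. \<Sum>i\<in>UNIV. B' $ i $ p i * (\<Prod>j\<in>UNIV - {i}. B z $ j $ p j)"
  have "((\<lambda>t. det (B t)) has_field_derivative (\<Sum>p\<in>?P. of_int (sign p) * ?d p)) (at z)"
    unfolding det_def
    by (intro DERIV_sum DERIV_cmult has_field_derivative_prod deriv)
  also have "(\<Sum>p\<in>?P. of_int (sign p) * ?d p) = (\<Sum>p\<in>?P. if p = id then trace B' else 0)"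
  proof (rule sum.cong[OF refl])
    fix p :: "'n \<Rightarrow> 'n" assume "p \<in> ?P"
    then have p: "bij p" by (simp add: permutes_bij)
    show "of_int (sign p) * ?d p = (if p = id then trace B' else 0)"
    proof (cases "p = id")
      case True
      then show ?thesis by (simp add: \<open>B z = mat 1\<close> mat_def trace_def sign_id)
    next
      case False
      have zero: "(\<Prod>j\<in>UNIV - {i}. B z $ j $ p j) = 0" for i
      proof -
        have "\<exists>j. j \<noteq> i \<and> j \<noteq> p j"
        proof (rule ccontr)
          assume "\<not> ?thesis"
          then have fixed: "p j = j" if "j \<noteq> i" for j using that by force
          then have "p i = i" using p by (metis bij_def injD)
          with fixed have "p j = j" for j by (cases "j = i") auto
          then have "p = id" by (simp add: fun_eq_iff)
          with False show False by contradiction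
        qed
        then show ?thesis by (auto intro!: prod_zero simp: \<open>B z = mat 1\<close> mat_def)
      qed
      show ?thesis using False by (simp only: zero) simp
    qed
  qed
  also have "\<dots> = trace B'"
    by (simp add: permutes_id)
  finally show ?thesis .
qed

text \<open>Jacobi's formula, reduced to the previous case by multiplying with the constant matrix
  \<open>G\<close>.\<close>

lemma det_has_field_derivative:
  fixes M :: "real \<Rightarrow> real^'n^'n"
  assumes deriv: "\<And>i j. ((\<lambda>t. M t $ i $ j) has_field_derivative M' $ i $ j) (at z)"
    and inv: "G ** M z = mat 1"
  shows "((\<lambda>t. det (M t)) has_field_derivative det (M z) * trace (G ** M')) (at z)"
proof -
  have "((\<lambda>t. det (G ** M t)) has_field_derivative trace (G ** M')) (at z)"
  proof (rule det_has_field_derivative_at_identity)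
    show "((\<lambda>t. (G ** M t) $ i $ j) has_field_derivative (G ** M') $ i $ j) (at z)" for i j
      unfolding matrix_matrix_mult_def by (simp add: DERIV_sum DERIV_cmult deriv)
  qed (rule inv)
  then have "((\<lambda>t. det (M z) * det (G ** M t)) has_field_derivative det (M z) * trace (G ** M')) (at z)"
    by (rule DERIV_cmult)
  moreover have "det (M z) * det G = 1"
    using arg_cong[OF inv, of det] by (simp add: det_mul mult.commute)
  then have "det (M z) * det (G ** M t) = det (M t)" for t
    by (simp add: det_mul flip: mult.assoc)
  ultimately show ?thesis by simp
qed

lemma matrix_inv_eqI:
  fixes A B :: "real^'n^'n"
  assumes "A ** B = mat 1"
  shows "matrix_inv A = B"
proof -
  have "B ** A = mat 1" using assms by (simp add: matrix_left_right_inverse)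
  with assms have "\<exists>C. A ** C = mat 1 \<and> C ** A = mat 1" by blast
  then have "A ** matrix_inv A = mat 1 \<and> matrix_inv A ** A = mat 1"
    unfolding matrix_inv_def by (rule someI_ex)
  then have "B ** (A ** matrix_inv A) = B" by simp
  then show ?thesis using \<open>B ** A = mat 1\<close> by (simp add: matrix_mul_assoc)
qed

section \<open>Generating function of geodesic paths and its matrix equation\<close>

definition geo_gf :: "'v::finite set set \<Rightarrow> real \<Rightarrow> 'v \<Rightarrow> 'v \<Rightarrow> real" where
  "geo_gf E t x z = (\<Sum>m. geo E m x z * t ^ m)"

definition bass_matrix :: "'v::finite set set \<Rightarrow> real \<Rightarrow> real^'v^'v" where
  "bass_matrix E t = mat 1 + t\<^sup>2 *\<^sub>R (degree_matrix E - mat 1) - t *\<^sub>R adjacency_matrix E"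

text \<open>The explicit inverse of \<open>bass_matrix\<close> for small \<open>t\<close>, as
  \<open>bass_matrix_mult_inverse\<close> shows.\<close>

definition bass_inverse :: "'v::finite set set \<Rightarrow> real \<Rightarrow> real^'v^'v" where
  "bass_inverse E t = (\<chi> x z. geo_gf E t x z / (1 - t\<^sup>2))"

lemma bass_matrix_nth: "bass_matrix E t $ x $ y
    = of_bool (x = y) * (1 + t\<^sup>2 * (real (vertex_degree E x) - 1)) - t * adj E x y"
  by (simp add: bass_matrix_def degree_matrix_def adjacency_matrix_def mat_def)

text \<open>\<open>q\<close> bounds the number of ways to continue a walk; the power series are
  controlled where \<open>abs t * q < 1\<close>.\<close>

locale nb_graph =
  fixes E :: "'v::finite set set" and q :: real
  assumes simple: "simple_graph E"
    and q_nonneg: "0 \<le> q"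
    and degree_le: "real (vertex_degree E x) \<le> q + 1"
begin

abbreviation dg :: "'v \<Rightarrow> real" where "dg x \<equiv> real (vertex_degree E x)"

lemma summable_geo:
  assumes "\<bar>t\<bar> * q < 1" shows "summable (\<lambda>m. geo E m x z * t ^ m)"
proof -
  have "summable (\<lambda>m. real CARD('v) * \<bar>t\<bar> * (\<bar>t\<bar> * q) ^ m)"
    using assms q_nonneg by (intro summable_mult summable_geometric) auto
  then have "summable (\<lambda>m. geo E (Suc m) x z * t ^ Suc m)"
  proof (rule summable_comparison_test'[where N = 0])
    fix m
    have "norm (geo E (Suc m) x z * t ^ Suc m) \<le> real CARD('v) * q ^ m * \<bar>t\<bar> ^ Suc m"
      using geo_Suc_le[OF simple degree_le q_nonneg] geo_nonneg[of E "Suc m" x z]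
      unfolding real_norm_def abs_mult power_abs by (intro mult_right_mono) auto
    then show "norm (geo E (Suc m) x z * t ^ Suc m) \<le> real CARD('v) * \<bar>t\<bar> * (\<bar>t\<bar> * q) ^ m"
      by (simp add: power_mult_distrib mult_ac)
  qed
  then show ?thesis by (subst (asm) summable_Suc_iff)
qed

lemma geo_gf_sums:
  "\<bar>t\<bar> * q < 1 \<Longrightarrow> (\<lambda>m. geo E m x z * t ^ m) sums geo_gf E t x z"
  unfolding geo_gf_def by (rule summable_sums[OF summable_geo])

lemma geo_gf_sums_Suc:
  assumes "\<bar>t\<bar> * q < 1"
  shows "(\<lambda>m. geo E (Suc m) x z * t ^ Suc m) sums (geo_gf E t x z - of_bool (x = z))"
  using geo_gf_sums[OF assms] by (subst sums_Suc_iff) simp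

lemma geo_gf_sums_Suc_Suc:
  assumes "\<bar>t\<bar> * q < 1"
  shows "(\<lambda>m. geo E (Suc (Suc m)) x z * t ^ Suc (Suc m)) sums
    (geo_gf E t x z - of_bool (x = z) - t * adj E x z)"
  using geo_gf_sums_Suc[OF assms, of x z] geo_1[of E x z]
  by (subst sums_Suc_iff) (simp add: mult.commute del: geo.simps)

text \<open>Multiply \<open>geo_rec\<close> by \<open>t ^ (m + 2)\<close> and sum over
  \<open>m\<close>: these are the entries of M(t) G(t) = (1 - t^2) I.\<close>

lemma geo_gf_eq:
  assumes "\<bar>t\<bar> * q < 1"
  shows "geo_gf E t x z - t * (\<Sum>y\<in>UNIV. adj E x y * geo_gf E t y z)
    + t\<^sup>2 * (dg x - 1) * geo_gf E t x z = (1 - t\<^sup>2) * of_bool (x = z)"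
proof -
  let ?G = "geo_gf E t"
  \<comment> \<open>The separate term at \<open>m = 0\<close> is the correction in
    \<open>geo_rec\<close>; it turns the diagonal entry 1 into 1 - t^2.\<close>
  have "(\<lambda>m. t * (\<Sum>y\<in>UNIV. adj E x y * (geo E (Suc m) y z * t ^ Suc m))
      - t\<^sup>2 * (dg x - 1) * (geo E m x z * t ^ m) - (if m = 0 then t\<^sup>2 * of_bool (x = z) else 0))
    sums (t * (\<Sum>y\<in>UNIV. adj E x y * (?G y z - of_bool (y = z)))
      - t\<^sup>2 * (dg x - 1) * ?G x z - t\<^sup>2 * of_bool (x = z))"
    by (intro sums_diff sums_mult sums_sum geo_gf_sums geo_gf_sums_Suc assms sums_single)
  also have "(\<lambda>m. t * (\<Sum>y\<in>UNIV. adj E x y * (geo E (Suc m) y z * t ^ Suc m))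
      - t\<^sup>2 * (dg x - 1) * (geo E m x z * t ^ m) - (if m = 0 then t\<^sup>2 * of_bool (x = z) else 0))
    = (\<lambda>m. geo E (Suc (Suc m)) x z * t ^ Suc (Suc m))"
  proof
    fix m
    show "t * (\<Sum>y\<in>UNIV. adj E x y * (geo E (Suc m) y z * t ^ Suc m))
      - t\<^sup>2 * (dg x - 1) * (geo E m x z * t ^ m) - (if m = 0 then t\<^sup>2 * of_bool (x = z) else 0)
      = geo E (Suc (Suc m)) x z * t ^ Suc (Suc m)"
      unfolding geo_rec[OF simple]
      by (simp add: algebra_simps sum_distrib_right sum_distrib_left power2_eq_square del: geo.simps)
  qed
  finally have "t * (\<Sum>y\<in>UNIV. adj E x y * (?G y z - of_bool (y = z)))
      - t\<^sup>2 * (dg x - 1) * ?G x z - t\<^sup>2 * of_bool (x = z) = ?G x z - of_bool (x = z) - t * adj E x z"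
    using geo_gf_sums_Suc_Suc[OF assms] by (rule sums_unique2)
  moreover have "(\<Sum>y\<in>UNIV. adj E x y * (?G y z - of_bool (y = z)))
      = (\<Sum>y\<in>UNIV. adj E x y * ?G y z) - adj E x z"
    by (simp add: right_diff_distrib sum_subtractf sum_mult_of_bool_eq)
  ultimately have "t * ((\<Sum>y\<in>UNIV. adj E x y * ?G y z) - adj E x z)
      - t\<^sup>2 * (dg x - 1) * ?G x z - t\<^sup>2 * of_bool (x = z) = ?G x z - of_bool (x = z) - t * adj E x z"
    by (simp only:)
  then show ?thesis by (simp only: right_diff_distrib left_diff_distrib mult_1_left)
qed

lemma bass_matrix_mult_inverse:
  assumes "\<bar>t\<bar> * q < 1" and "t\<^sup>2 \<noteq> 1"
  shows "bass_matrix E t ** bass_inverse E t = mat 1"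
proof -
  have "(bass_matrix E t ** bass_inverse E t) $ x $ z = mat 1 $ x $ z" for x z
  proof -
    let ?c = "1 + t\<^sup>2 * (dg x - 1)" and ?G = "geo_gf E t"
    have "(bass_matrix E t ** bass_inverse E t) $ x $ z
        = (\<Sum>y\<in>UNIV. (of_bool (x = y) * ?c - t * adj E x y) * (?G y z / (1 - t\<^sup>2)))"
      by (simp add: matrix_matrix_mult_def bass_matrix_nth bass_inverse_def)
    also have "\<dots> = ((\<Sum>y\<in>UNIV. of_bool (x = y) * (?c * ?G y z)) - t * (\<Sum>y\<in>UNIV. adj E x y * ?G y z))
        / (1 - t\<^sup>2)"
      by (simp add: sum_distrib_left left_diff_distrib diff_divide_distrib sum_divide_distrib
          sum_subtractf mult.assoc)
    also have "\<dots> = (1 - t\<^sup>2) * of_bool (x = z) / (1 - t\<^sup>2)"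
      unfolding sum_of_bool_eq_mult geo_gf_eq[OF assms(1), symmetric] by (simp add: algebra_simps)
    also have "\<dots> = mat 1 $ x $ z"
      using assms(2) by (simp add: mat_def)
    finally show ?thesis .
  qed
  then show ?thesis by (simp add: vec_eq_iff)
qed

section \<open>Generating functions of the loop counts\<close>

definition geo_trace :: "real \<Rightarrow> real" where
  "geo_trace t = (\<Sum>x\<in>UNIV. geo_gf E t x x)"

lemma geodesic_based_loops_sums:
  assumes "\<bar>t\<bar> * q < 1"
  shows "(\<lambda>m. real (num_geodesic_based_loops E (Suc m)) * t ^ Suc m) sums (geo_trace t - real CARD('v))"
proof -
  have "(\<lambda>m. \<Sum>x\<in>UNIV. geo E (Suc m) x x * t ^ Suc m) sums
      (\<Sum>x\<in>UNIV. geo_gf E t x x - of_bool (x = x))"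
    by (intro sums_sum geo_gf_sums_Suc assms)
  then show ?thesis
    by (simp add: num_geodesic_based_loops_Suc sum_distrib_right sum_subtractf geo_trace_def
        del: geo.simps)
qed

lemma num_geodesic_based_loops_0: "num_geodesic_based_loops E 0 = 0"
  by (auto simp: num_geodesic_based_loops_def geodesic_based_loop_def based_loop_def)

lemma num_geodesic_based_loops_1: "num_geodesic_based_loops E (Suc 0) = 0"
proof -
  have "real (num_geodesic_based_loops E (Suc 0)) = 0"
    using simple_graph_irrefl[OF simple] by (simp add: num_geodesic_based_loops_Suc geo_1 del: geo.simps)
  then show ?thesis by simp
qed

lemma has_sum_geodesic_based_loops:
  assumes "0 \<le> t" "t * q < 1"
  shows "((\<lambda>m. real (num_geodesic_based_loops E m) * t ^ m) has_sum (geo_trace t - real CARD('v))) {2..}"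
proof -
  have "\<bar>t\<bar> * q < 1" using assms by simp
  from geodesic_based_loops_sums[OF this]
  have "(\<lambda>m. real (num_geodesic_based_loops E m) * t ^ m) sums (geo_trace t - real CARD('v))"
    by (subst (asm) sums_Suc_iff) (simp add: num_geodesic_based_loops_0)
  then have "((\<lambda>m. real (num_geodesic_based_loops E m) * t ^ m) has_sum (geo_trace t - real CARD('v))) UNIV"
    using assms by (intro sums_nonneg_imp_has_sum) auto
  also have "?this \<longleftrightarrow> ?thesis"
  proof (rule has_sum_cong_neutral)
    fix m assume "m \<in> UNIV - {2 :: nat ..}"
    then have "m = 0 \<or> m = Suc 0" by auto
    then show "real (num_geodesic_based_loops E m) * t ^ m = 0"
      by (auto simp: num_geodesic_based_loops_0 num_geodesic_based_loops_1)
  qed auto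
  finally show ?thesis .
qed

lemma summable_closed_nb:
  assumes "\<bar>t\<bar> * q < 1" shows "summable (\<lambda>m. closed_nb E m * t ^ m)"
proof -
  have "summable (\<lambda>m. (real CARD('v))\<^sup>2 * (\<bar>t\<bar> * q) ^ m)"
    using assms q_nonneg by (intro summable_mult summable_geometric) auto
  then show ?thesis
  proof (rule summable_comparison_test'[where N = 0])
    fix m
    have "norm (closed_nb E m * t ^ m) \<le> (real CARD('v))\<^sup>2 * q ^ m * \<bar>t\<bar> ^ m"
      using closed_nb_le[OF simple degree_le q_nonneg, of m] closed_nb_nonneg[of E m]
      unfolding real_norm_def abs_mult power_abs by (intro mult_right_mono) auto
    then show "norm (closed_nb E m * t ^ m) \<le> (real CARD('v))\<^sup>2 * (\<bar>t\<bar> * q) ^ m"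
      by (simp add: power_mult_distrib mult_ac)
  qed
qed

definition closed_gf :: "real \<Rightarrow> real" where
  "closed_gf t = (\<Sum>m. closed_nb E m * t ^ m)"

lemma closed_nb_0: "closed_nb E 0 = 0"
  by (simp add: closed_nb_def)

lemma closed_nb_1: "closed_nb E (Suc 0) = 0"
  by (auto simp: closed_nb_def intro!: sum.neutral)

text \<open>Sum \<open>closed_nb_rec\<close> against \<open>t ^ (m + 2)\<close>. The counts for
  lengths 0 and 1 vanish, so the left side is 1 - t^2 times the series.\<close>

lemma closed_gf_eq:
  assumes "\<bar>t\<bar> * q < 1"
  shows "(1 - t\<^sup>2) * closed_gf t = (\<Sum>x\<in>UNIV. (1 - t\<^sup>2 * (dg x - 1)) * geo_gf E t x x)
    + (\<Sum>x\<in>UNIV. t\<^sup>2 * (dg x - 1) - 1)"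
proof -
  let ?c = "closed_nb E" and ?T = "\<lambda>m. \<Sum>x\<in>UNIV. geo E m x x"
  have c: "(\<lambda>m. ?c m * t ^ m) sums closed_gf t"
    unfolding closed_gf_def by (rule summable_sums[OF summable_closed_nb[OF assms]])
  then have "(\<lambda>m. ?c (Suc m) * t ^ Suc m) sums closed_gf t"
    by (subst sums_Suc_iff) (simp add: closed_nb_0)
  then have "(\<lambda>m. ?c (Suc (Suc m)) * t ^ Suc (Suc m)) sums closed_gf t"
    by (subst sums_Suc_iff) (simp add: closed_nb_1)
  then have "(\<lambda>m. ?c (Suc (Suc m)) * t ^ Suc (Suc m) - t\<^sup>2 * (?c m * t ^ m)) sums
      (closed_gf t - t\<^sup>2 * closed_gf t)"
    by (intro sums_diff sums_mult c)
  \<comment> \<open>The factor \<open>of_bool (m \<noteq> 0)\<close> is realised as the full series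
    minus its term at \<open>m = 0\<close>, where \<open>geo\<close> is 1 on the diagonal.\<close>
  also have "(\<lambda>m. ?c (Suc (Suc m)) * t ^ Suc (Suc m) - t\<^sup>2 * (?c m * t ^ m))
    = (\<lambda>m. (\<Sum>x\<in>UNIV. geo E (Suc (Suc m)) x x * t ^ Suc (Suc m))
        - ((\<Sum>x\<in>UNIV. t\<^sup>2 * (dg x - 1) * (geo E m x x * t ^ m))
          - (if m = 0 then \<Sum>x\<in>UNIV. t\<^sup>2 * (dg x - 1) else 0)))"
  proof
    fix m
    have "?c (Suc (Suc m)) * t ^ Suc (Suc m) - t\<^sup>2 * (?c m * t ^ m)
        = (?c (Suc (Suc m)) - ?c m) * t ^ Suc (Suc m)"
      by (simp add: algebra_simps power2_eq_square)
    also have "\<dots> = (?T (Suc (Suc m)) - of_bool (m \<noteq> 0) * (\<Sum>x\<in>UNIV. (dg x - 1) * geo E m x x))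
        * t ^ Suc (Suc m)"
      unfolding closed_nb_rec[OF simple] ..
    also have "\<dots> = (\<Sum>x\<in>UNIV. geo E (Suc (Suc m)) x x * t ^ Suc (Suc m))
        - of_bool (m \<noteq> 0) * (\<Sum>x\<in>UNIV. t\<^sup>2 * (dg x - 1) * (geo E m x x * t ^ m))"
      unfolding left_diff_distrib[of "?T (Suc (Suc m))"] mult.assoc[of "of_bool (m \<noteq> 0)"] sum_distrib_right
      by (simp add: power2_eq_square mult_ac del: geo.simps)
    finally show "?c (Suc (Suc m)) * t ^ Suc (Suc m) - t\<^sup>2 * (?c m * t ^ m)
        = (\<Sum>x\<in>UNIV. geo E (Suc (Suc m)) x x * t ^ Suc (Suc m))
        - ((\<Sum>x\<in>UNIV. t\<^sup>2 * (dg x - 1) * (geo E m x x * t ^ m))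
          - (if m = 0 then \<Sum>x\<in>UNIV. t\<^sup>2 * (dg x - 1) else 0))"
      by (cases "m = 0") (simp_all del: geo.simps(2))
  qed
  finally have l: "(\<lambda>m. (\<Sum>x\<in>UNIV. geo E (Suc (Suc m)) x x * t ^ Suc (Suc m))
        - ((\<Sum>x\<in>UNIV. t\<^sup>2 * (dg x - 1) * (geo E m x x * t ^ m))
          - (if m = 0 then \<Sum>x\<in>UNIV. t\<^sup>2 * (dg x - 1) else 0))) sums
      (closed_gf t - t\<^sup>2 * closed_gf t)" .
  have "(\<lambda>m. (\<Sum>x\<in>UNIV. geo E (Suc (Suc m)) x x * t ^ Suc (Suc m))
        - ((\<Sum>x\<in>UNIV. t\<^sup>2 * (dg x - 1) * (geo E m x x * t ^ m))
          - (if m = 0 then \<Sum>x\<in>UNIV. t\<^sup>2 * (dg x - 1) else 0))) sums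
      ((\<Sum>x\<in>UNIV. geo_gf E t x x - of_bool (x = x) - t * adj E x x)
        - ((\<Sum>x\<in>UNIV. t\<^sup>2 * (dg x - 1) * geo_gf E t x x) - (\<Sum>x\<in>UNIV. t\<^sup>2 * (dg x - 1))))"
    by (intro sums_diff sums_sum sums_mult sums_single geo_gf_sums geo_gf_sums_Suc_Suc assms)
  from sums_unique2[OF l this] show ?thesis
    using simple_graph_irrefl[OF simple]
    by (simp add: algebra_simps sum.distrib sum_subtractf flip: sum_distrib_left)
qed

section \<open>Logarithmic derivatives\<close>

definition bass_matrix' :: "real \<Rightarrow> real^'v^'v" where
  "bass_matrix' t = (\<chi> x y. of_bool (x = y) * (2 * t * (dg x - 1)) - adj E x y)"

lemma bass_matrix_deriv:
  "((\<lambda>t. bass_matrix E t $ x $ y) has_field_derivative bass_matrix' t $ x $ y) (at t)"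
  unfolding bass_matrix_nth bass_matrix'_def by (auto intro!: derivative_eq_intros)

text \<open>Since t M' = M - I + t^2 (D - I), the trace of t M^-1 M' is that of I - (I - t^2 (D -
  I)) M^-1. Adding \<open>closed_gf_eq\<close>, the traces involving M^-1 cancel, and the handshake
  lemma evaluates the remaining degree sum.\<close>

lemma trace_log_deriv:
  assumes "\<bar>t\<bar> * q < 1" and "t\<^sup>2 \<noteq> 1"
  shows "closed_gf t + t * trace (bass_inverse E t ** bass_matrix' t)
    = 2 * real_of_int (chi E) * t\<^sup>2 / (1 - t\<^sup>2)"
proof -
  let ?I = "bass_inverse E t"
  have "?I ** bass_matrix E t = mat 1"
    using bass_matrix_mult_inverse[OF assms] by (simp add: matrix_left_right_inverse)
  then have "(?I ** bass_matrix E t) $ x $ x = 1" for x by (simp add: mat_def)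
  then have diag: "(\<Sum>y\<in>UNIV. ?I $ x $ y * (of_bool (y = x) * (1 + t\<^sup>2 * (dg y - 1)) - t * adj E y x)) = 1" for x
    by (simp add: matrix_matrix_mult_def bass_matrix_nth)
  have "t * (?I ** bass_matrix' t) $ x $ x = 1 - (1 - t\<^sup>2 * (dg x - 1)) * ?I $ x $ x" for x
  proof -
    have "t * (?I ** bass_matrix' t) $ x $ x - (\<Sum>y\<in>UNIV. ?I $ x $ y *
        (of_bool (y = x) * (1 + t\<^sup>2 * (dg y - 1)) - t * adj E y x))
      = (\<Sum>y\<in>UNIV. of_bool (x = y) * (?I $ x $ y * (t\<^sup>2 * (dg y - 1) - 1)))"
      unfolding matrix_matrix_mult_def bass_matrix'_def
      unfolding vec_lambda_beta sum_distrib_left sum_subtractf[symmetric]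
      by (intro sum.cong) (auto simp: algebra_simps power2_eq_square)
    then show ?thesis unfolding diag sum_of_bool_eq_mult by (simp add: algebra_simps)
  qed
  then have "t * trace (?I ** bass_matrix' t) = (\<Sum>x\<in>UNIV. 1 - (1 - t\<^sup>2 * (dg x - 1)) * ?I $ x $ x)"
    by (simp add: trace_def sum_distrib_left)
  then have "(1 - t\<^sup>2) * (t * trace (?I ** bass_matrix' t))
      = (\<Sum>x\<in>UNIV. (1 - t\<^sup>2) - (1 - t\<^sup>2 * (dg x - 1)) * ((1 - t\<^sup>2) * ?I $ x $ x))"
    by (simp add: sum_distrib_left algebra_simps)
  also have "\<dots> = (1 - t\<^sup>2) * real CARD('v) - (\<Sum>x\<in>UNIV. (1 - t\<^sup>2 * (dg x - 1)) * geo_gf E t x x)"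
    using assms(2) by (simp add: bass_inverse_def sum_subtractf mult.commute)
  finally have "(1 - t\<^sup>2) * (closed_gf t + t * trace (?I ** bass_matrix' t))
      = (1 - t\<^sup>2) * real CARD('v) + (\<Sum>x\<in>UNIV. t\<^sup>2 * (dg x - 1) - 1)"
    by (simp add: distrib_left closed_gf_eq[OF assms(1)])
  also have "\<dots> = t\<^sup>2 * ((\<Sum>x\<in>UNIV. dg x) - 2 * real CARD('v))"
    by (simp add: sum_subtractf sum_distrib_left algebra_simps)
  also have "(\<Sum>x\<in>UNIV. dg x) = 2 * real (card E)"
    using arg_cong[OF sum_degrees[OF simple], of real] by simp
  finally have "(closed_gf t + t * trace (?I ** bass_matrix' t)) * (1 - t\<^sup>2)
      = 2 * real_of_int (chi E) * t\<^sup>2"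
    by (simp add: chi_def algebra_simps)
  then show ?thesis
    using assms(2) by (subst eq_divide_eq) simp
qed

text \<open>The exponent of the Euler product, indexed by \<open>Suc m\<close> to avoid division by
  zero and to suit termwise differentiation.\<close>

definition log_zeta :: "real \<Rightarrow> real" where
  "log_zeta t = (\<Sum>m. closed_nb E (Suc m) / real (Suc m) * t ^ Suc m)"

lemma log_zeta_deriv:
  assumes "0 < R" "R * q < 1" "\<bar>t\<bar> < R"
  shows "(log_zeta has_field_derivative (\<Sum>m. closed_nb E (Suc m) * t ^ m)) (at t)"
proof -
  have smaller: "\<bar>x\<bar> * q < 1" if "\<bar>x\<bar> < R" for x
    using mult_right_mono[of "\<bar>x\<bar>" R q] that assms q_nonneg by simp
  have "DERIV (\<lambda>x. \<Sum>m. closed_nb E (Suc m) / real (Suc m) * x ^ Suc m) t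
      :> (\<Sum>m. closed_nb E (Suc m) / real (Suc m) * real (Suc m) * t ^ m)"
  proof (rule DERIV_power_series'[where R = R])
    fix x assume "x \<in> {-R<..<R}"
    then have "summable (\<lambda>m. closed_nb E m * x ^ m)"
      by (intro summable_closed_nb smaller) auto
    then have "summable (\<lambda>m. closed_nb E (Suc m) * x ^ Suc m)" by (subst summable_Suc_iff)
    then have "x \<noteq> 0 \<Longrightarrow> summable (\<lambda>m. closed_nb E (Suc m) * x ^ Suc m / x)"
      by (intro summable_divide)
    then have "summable (\<lambda>m. closed_nb E (Suc m) * x ^ m)"
      by (cases "x = 0") (simp, auto intro: summable_finite[of "{0}"])
    then show "summable (\<lambda>m. closed_nb E (Suc m) / real (Suc m) * real (Suc m) * x ^ m)"
      by simp
  qed (use assms in auto)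
  then show ?thesis by (simp add: log_zeta_def[abs_def])
qed

lemma closed_gf_eq_mult:
  assumes "\<bar>t\<bar> * q < 1" "t \<noteq> 0"
  shows "(\<Sum>m. closed_nb E (Suc m) * t ^ m) = closed_gf t / t"
proof -
  have "(\<lambda>m. closed_nb E m * t ^ m) sums closed_gf t"
    unfolding closed_gf_def by (rule summable_sums[OF summable_closed_nb[OF assms(1)]])
  then have "(\<lambda>m. closed_nb E (Suc m) * t ^ Suc m) sums closed_gf t"
    by (subst sums_Suc_iff) (simp add: closed_nb_0)
  then have "(\<lambda>m. closed_nb E (Suc m) * t ^ Suc m / t) sums (closed_gf t / t)"
    by (rule sums_divide)
  then show ?thesis using assms(2) by (simp add: sums_iff)
qed

text \<open>By Jacobi's formula and the previous lemmas the logarithmic derivative of this product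
  is zero on \<open>(0, u)\<close>, and its value at 0 is 1.\<close>

lemma exp_log_zeta_mult_det:
  assumes u: "0 < u" "u < 1" "u * q < 1"
  shows "exp (log_zeta u) * det (bass_matrix E u) * (1 - u\<^sup>2) powi chi E = 1"
proof -
  let ?F = "\<lambda>t. exp (log_zeta t) * det (bass_matrix E t) * (1 - t\<^sup>2) powi chi E"
  \<comment> \<open>A radius beyond \<open>u\<close> within which the series converges, so that
    \<open>log_zeta\<close> is differentiable at the endpoint \<open>u\<close> as well.\<close>
  obtain R where R: "u < R" "R * q < 1"
  proof (cases "q = 0")
    case True
    then show ?thesis using that[of "u + 1"] by simp
  next
    case False
    then have "0 < q" "u < 1 / q" using q_nonneg u by (auto simp: field_simps)
    then obtain R where "u < R" "R < 1 / q" using dense by blast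
    then show ?thesis using that \<open>0 < q\<close> by (simp add: field_simps)
  qed
  have deriv: "(?F has_field_derivative ?F t * ((\<Sum>m. closed_nb E (Suc m) * t ^ m)
      + trace (bass_inverse E t ** bass_matrix' t) - 2 * real_of_int (chi E) * t / (1 - t\<^sup>2))) (at t)"
    if t: "0 \<le> t" "t \<le> u" for t
  proof -
    have sq: "t\<^sup>2 < 1" using t u by (simp add: power_less_one_iff)
    have tq: "\<bar>t\<bar> * q < 1"
      using t u q_nonneg mult_right_mono[of t u q] by simp
    have "bass_inverse E t ** bass_matrix E t = mat 1"
      using bass_matrix_mult_inverse[OF tq] sq by (simp add: matrix_left_right_inverse)
    note det = det_has_field_derivative[where M = "bass_matrix E", OF bass_matrix_deriv this]
    have log: "(log_zeta has_field_derivative (\<Sum>m. closed_nb E (Suc m) * t ^ m)) (at t)"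
      using t u R by (intro log_zeta_deriv[of R]) auto
    have pow: "((\<lambda>t. (1 - t\<^sup>2) powi chi E) has_field_derivative
        (1 - t\<^sup>2) powi chi E * (- 2 * real_of_int (chi E) * t / (1 - t\<^sup>2))) (at t)"
      using sq by (auto intro!: derivative_eq_intros simp: power_int_diff)
    show ?thesis
      by (rule DERIV_cong[OF DERIV_mult[OF DERIV_mult[OF DERIV_chain2[OF DERIV_exp log] det] pow]])
        (simp add: algebra_simps)
  qed
  have "?F u = ?F 0"
  proof (rule DERIV_isconst_end[where f = ?F])
    show "continuous_on {0..u} ?F"
      using deriv by (intro continuous_at_imp_continuous_on ballI DERIV_isCont[OF deriv]) auto
    fix t assume t: "0 < t" "t < u"
    have sq: "t\<^sup>2 < 1" using t u by (simp add: power_less_one_iff)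
    have tq: "\<bar>t\<bar> * q < 1"
      using t u q_nonneg mult_right_mono[of t u q] by simp
    \<comment> \<open>\<open>trace_log_deriv\<close> gives the logarithmic derivative only up to the
      factor \<open>t\<close>, which cancels for positive \<open>t\<close>.\<close>
    have "t * (closed_gf t / t + trace (bass_inverse E t ** bass_matrix' t)
        - 2 * real_of_int (chi E) * t / (1 - t\<^sup>2)) = 0"
      using trace_log_deriv[OF tq] sq t by (simp add: distrib_left right_diff_distrib power2_eq_square mult_ac)
    then have "(\<Sum>m. closed_nb E (Suc m) * t ^ m) + trace (bass_inverse E t ** bass_matrix' t)
        - 2 * real_of_int (chi E) * t / (1 - t\<^sup>2) = 0"
      using t closed_gf_eq_mult[OF tq] by simp
    then show "DERIV ?F t :> 0" using deriv[of t] t by simp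
  qed (rule u)
  also have "?F 0 = 1"
    by (simp add: log_zeta_def bass_matrix_def)
  finally show ?thesis .
qed

text \<open>Group the cycles by length and use \<open>card_cycles\<close>; since the terms are
  nonnegative, the series over lengths gives an unordered sum over cycles.\<close>

lemma has_sum_cycles:
  assumes "0 < u" "u * q < 1"
  shows "((\<lambda>xs. u ^ length xs / length xs) has_sum log_zeta u) (cycles E)"
proof -
  let ?C = "\<lambda>m. {xs \<in> cycles E. length xs = m}"
  let ?c = "\<lambda>m. closed_nb E m / real m * u ^ m"
  have uq: "\<bar>u\<bar> * q < 1" using assms by simp
  have "summable (\<lambda>m. closed_nb E (Suc m) * u ^ Suc m)"
    using summable_closed_nb[OF uq] by (subst summable_Suc_iff)
  then have "summable (\<lambda>m. closed_nb E (Suc m) / real (Suc m) * u ^ Suc m)"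
  proof (rule summable_comparison_test'[where N = 0])
    fix m
    have "closed_nb E (Suc m) / real (Suc m) \<le> closed_nb E (Suc m)"
      using closed_nb_nonneg[of E "Suc m"] by (simp add: divide_le_eq mult_left_mono distrib_left)
    then show "norm (closed_nb E (Suc m) / real (Suc m) * u ^ Suc m) \<le> closed_nb E (Suc m) * u ^ Suc m"
      using closed_nb_nonneg[of E "Suc m"] assms
      unfolding real_norm_def abs_mult
      by (intro mult_mono) (simp_all only: abs_of_nonneg zero_le_power zero_le_divide_iff, auto)
  qed
  then have "(\<lambda>m. closed_nb E (Suc m) / real (Suc m) * u ^ Suc m) sums log_zeta u"
    unfolding log_zeta_def by (rule summable_sums)
  then have "?c sums log_zeta u"
    by (subst (asm) sums_Suc_iff) simp
  then have outer: "(?c has_sum log_zeta u) UNIV"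
    using assms by (intro sums_nonneg_imp_has_sum) (auto intro!: mult_nonneg_nonneg divide_nonneg_nonneg closed_nb_nonneg simp del: times_divide_eq_left)
  have inner: "((\<lambda>xs. u ^ length xs / length xs) has_sum ?c m) (?C m)" for m
  proof -
    have "finite (?C m)"
      by (rule finite_subset[OF _ finite_lists_length_eq[of "UNIV :: 'v set" m]]) auto
    then have "((\<lambda>xs. u ^ length xs / length xs) has_sum (\<Sum>xs\<in>?C m. u ^ length xs / length xs)) (?C m)"
      by (rule has_sum_finite)
    also have "(\<Sum>xs\<in>?C m. u ^ length xs / length xs) = (\<Sum>xs\<in>?C m. u ^ m / m)"
      by (intro sum.cong) auto
    also have "\<dots> = ?c m"
      by (simp add: card_cycles[OF simple])
    finally show ?thesis .
  qed
  have "((\<lambda>(m, xs). u ^ length xs / length xs) has_sum log_zeta u) (Sigma UNIV ?C)"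
  proof (rule has_sum_SigmaI[OF _ outer])
    show "(\<lambda>(m, xs). u ^ length xs / length xs) summable_on Sigma UNIV ?C"
      using assms by (intro summable_on_SigmaI[of _ _ _ ?c] has_sum_imp_summable[OF outer])
        (simp_all only: prod.case inner, simp)
  qed (simp only: prod.case inner)
  then have "((\<lambda>p. u ^ length (snd p) / length (snd p)) has_sum log_zeta u) (Sigma UNIV ?C)"
    by (simp only: case_prod_unfold)
  moreover have "bij_betw snd (Sigma UNIV ?C) (cycles E)"
    by (rule bij_betw_byWitness[where f' = "\<lambda>xs. (length xs, xs)"]) auto
  ultimately show ?thesis
    by (subst (asm) has_sum_reindex_bij_betw)
qed

end

text \<open>In the extended reals a vertex of degree 1 gives \<open>1 / 0\<close>, which is infinite
  and puts no bound on \<open>u\<close>, whereas degree 0 gives -1, which is incompatible with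
  \<open>0 < u\<close>.\<close>

lemma vertex_degree_bound:
  assumes "0 < u" and "ereal u < (INF x. 1 / (ereal (real (vertex_degree E x)) - 1))"
  shows "1 \<le> vertex_degree E x" and "u * (real (vertex_degree E x) - 1) < 1"
proof -
  let ?d = "real (vertex_degree E x)"
  have "ereal u < 1 / (ereal ?d - 1)"
    using assms(2) by (rule less_INF_D) simp
  then have u: "ereal u < 1 / ereal (?d - 1)" by (simp add: one_ereal_def)
  show "1 \<le> vertex_degree E x"
  proof (rule ccontr)
    assume "\<not> 1 \<le> vertex_degree E x"
    then have "vertex_degree E x = 0" by simp
    then show False using u assms(1) by (simp add: one_ereal_def)
  qed
  then consider "?d - 1 = 0" | "0 < ?d - 1" by (cases "vertex_degree E x = 1") auto
  then show "u * (?d - 1) < 1"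
  proof cases
    case 2
    then have "u < 1 / (?d - 1)" using u by (simp add: one_ereal_def)
    then show ?thesis using 2 by (simp add: field_simps)
  qed simp
qed

text \<open>Invertibility and convergence are asserted along with the formulas because
  \<open>matrix_inv\<close> and \<open>unordered_prod\<close> have values even where no inverse or
  limit exists.\<close>

theorem theorem1:
  fixes E :: "'v::finite set set" and u :: real
  assumes "simple_graph E" and "connected_graph E"
    and "0 < u" and "u < 1"
    and "ereal u < (INF x. 1 / (ereal (real (vertex_degree E x)) - 1))"
  shows "invertible (mat 1 + u\<^sup>2 *\<^sub>R (degree_matrix E - mat 1) - u *\<^sub>R adjacency_matrix E) \<and>
    ((\<lambda>m. real (num_geodesic_based_loops E m) * u ^ m) has_sum
      ((1 - u\<^sup>2) * trace (matrix_inv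
          (mat 1 + u\<^sup>2 *\<^sub>R (degree_matrix E - mat 1) - u *\<^sub>R adjacency_matrix E))
        - real CARD('v))) {2..} \<and>
    unordered_prod_converges (ihara_factor u) (primitive_geodesic_loops E) \<and>
    ihara_zeta E u = (1 - u\<^sup>2) powi (- chi E) *
      inverse (det (mat 1 - u *\<^sub>R adjacency_matrix E + u\<^sup>2 *\<^sub>R (degree_matrix E - mat 1)))"
proof -
  note u = \<open>0 < u\<close> \<open>u < 1\<close> and deg = vertex_degree_bound[OF assms(3,5)]
  define q where "q = Max (range (\<lambda>x. real (vertex_degree E x) - 1))"
  have le: "real (vertex_degree E x) - 1 \<le> q" for x
    unfolding q_def by (rule Max_ge) auto
  \<comment> \<open>The maximum is attained at some vertex, whose bounds from
    \<open>vertex_degree_bound\<close> therefore hold for \<open>q\<close>.\<close>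
  have "q \<in> range (\<lambda>x. real (vertex_degree E x) - 1)"
    unfolding q_def by (rule Max_in) auto
  then have q: "0 \<le> q" "u * q < 1" using deg by force+
  interpret nb_graph E q
    by unfold_locales (use assms(1) q le in \<open>auto simp: algebra_simps\<close>)
  have sq: "u\<^sup>2 < 1" using u by (simp add: power_less_one_iff)
  have inv: "bass_matrix E u ** bass_inverse E u = mat 1"
    using q u sq by (intro bass_matrix_mult_inverse) auto
  have "invertible (bass_matrix E u)"
    using inv by (auto simp: invertible_right_inverse)
  moreover have "(1 - u\<^sup>2) * trace (matrix_inv (bass_matrix E u)) = geo_trace u"
    unfolding matrix_inv_eqI[OF inv]
    using sq by (simp add: trace_def bass_inverse_def geo_trace_def sum_distrib_left)
  then have "((\<lambda>m. real (num_geodesic_based_loops E m) * u ^ m) has_sum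
      ((1 - u\<^sup>2) * trace (matrix_inv (bass_matrix E u)) - real CARD('v))) {2..}"
    using has_sum_geodesic_based_loops[of u] u q by simp
  moreover have lim: "(prod (ihara_factor u) \<longlongrightarrow> exp (log_zeta u))
      (finite_subsets_at_top (primitive_geodesic_loops E))"
    by (intro tendsto_prod_ihara_factor u has_sum_cycles q)
  then have "unordered_prod_converges (ihara_factor u) (primitive_geodesic_loops E)"
    unfolding unordered_prod_converges_def by (intro exI[of _ "exp (log_zeta u)"]) simp
  moreover have "ihara_zeta E u = (1 - u\<^sup>2) powi (- chi E) * inverse (det (bass_matrix E u))"
  proof -
    have "ihara_zeta E u = exp (log_zeta u)"
      unfolding ihara_zeta_def unordered_prod_def
      by (rule tendsto_Lim[OF finite_subsets_at_top_neq_bot lim])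
    also have "\<dots> = inverse (det (bass_matrix E u) * (1 - u\<^sup>2) powi chi E)"
      using exp_log_zeta_mult_det[OF u q(2)] by (intro inverse_unique[symmetric]) (simp add: mult_ac)
    finally show ?thesis by (simp add: power_int_minus mult.commute)
  qed
  moreover have "mat 1 - u *\<^sub>R adjacency_matrix E + u\<^sup>2 *\<^sub>R (degree_matrix E - mat 1) = bass_matrix E u"
    by (simp add: bass_matrix_def)
  ultimately show ?thesis
    by (simp only: flip: bass_matrix_def)
qed

end
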